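(* Let $p>0$, $M_p>0$ and let $n\ge 3$ be an integer with $M_p^{1/p}\le n^{10}$. Suppose $Y^n=(Y_1,\ldots,Y_n)$ are i.i.d. observations from $f_G$, where $G\in\mathcal{G}_p(M_p)$. Let $$\epsilon_n = \big(n^{-p/(2p+1)}M_p^{1/(4p+2)}\vee n^{-1/2}\big)(\log n)^4 .$$ Then there exists some $t_*=t_*(p)$, depending only on $p$, such that for all $t\ge t_*$, $$\mathbb{P}_G\big(H(f_{\hat G},f_G)\ge t\epsilon_n\big)\le 2\exp\big(-t^2n\epsilon_n^2/(8\log n)\big)\le 2\exp\big(-t^2(\log n)^2/8\big),$$ where $\hat G$ is the nonparametric maximum likelihood estimator (NPMLE) based on $Y^n$. Consequently, there exists some $C=C(p)>0$, depending only on $p$, such that $\mathbb{E}_G H^2(f_{\hat G},f_G)\le C\epsilon_n^2$ uniformly over $G\in\mathcal{G}_p(M_p)$.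
   Context: $\mathbb{R}_+=[0,\infty)$, $\mathbb{Z}_+=\{0,1,2,\ldots\}$, $a\vee b=\max\{a,b\}$. $\mathcal{P}(\mathbb{R}_+)$ is the set of Borel probability measures on $\mathbb{R}_+$. $\mathrm{Poi}(y;\theta)=e^{-\theta}\theta^y/y!$ for $y\in\mathbb{Z}_+$, $\theta\ge 0$ (with $0^0=1$). For $G\in\mathcal{P}(\mathbb{R}_+)$ the Poisson mixture is $f_G(y)=\int \mathrm{Poi}(y;\theta)\,G(d\theta)$, and $m_p(G)=\int u^p\,G(du)$. $\mathcal{G}_p(M_p)=\{G\in\mathcal{P}(\mathbb{R}_+): m_p(G)\le M_p\}$. The squared Hellinger distance between probability mass functions on $\mathbb{Z}_+$ is $H^2(f,g)=\sum_{y\ge 0}(\sqrt{f(y)}-\sqrt{g(y)})^2$. The NPMLE is $\hat G=\arg\max_{Q\in\mathcal{P}(\mathbb{R}_+)}\prod_{i=1}^n f_Q(Y_i)$ (the maximizer exists and is unique). $\mathbb{P}_G,\mathbb{E}_G$ are with respect to $Y_1,\ldots,Y_n$ i.i.d. from $f_G$. *)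

theory Defs
  imports "HOL-Probability.Probability"
begin

definition prob_nonneg :: "real measure set" where
  "prob_nonneg = space (prob_algebra (restrict_space borel {0..}))"

text \<open>The library's Poisson distribution requires a strictly positive rate, whereas mixing
  distributions may charge \<open>0\<close>; here \<open>Poi 0 0 = 1\<close> since \<open>0 ^ 0 = 1\<close>.\<close>

definition Poi :: "nat \<Rightarrow> real \<Rightarrow> real" where
  "Poi y \<theta> = exp (- \<theta>) * \<theta> ^ y / fact y"

definition mixture :: "real measure \<Rightarrow> nat \<Rightarrow> real" where
  "mixture G y = (\<integral>\<theta>. Poi y \<theta> \<partial>G)"

text \<open>Moments take values in \<open>ennreal\<close>, so that an infinite moment is not confused with \<open>0\<close>.\<close>

definition moment :: "real \<Rightarrow> real measure \<Rightarrow> ennreal" where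
  "moment p G = (\<integral>\<^sup>+u. ennreal (u powr p) \<partial>G)"

definition moment_class :: "real \<Rightarrow> real \<Rightarrow> real measure set" where
  "moment_class p Mp = {G \<in> prob_nonneg. moment p G \<le> ennreal Mp}"

definition hellinger_sq :: "(nat \<Rightarrow> real) \<Rightarrow> (nat \<Rightarrow> real) \<Rightarrow> real" where
  "hellinger_sq f g = (\<Sum>y. (sqrt (f y) - sqrt (g y))\<^sup>2)"

definition hellinger :: "(nat \<Rightarrow> real) \<Rightarrow> (nat \<Rightarrow> real) \<Rightarrow> real" where
  "hellinger f g = sqrt (hellinger_sq f g)"

text \<open>The joint law of \<open>n\<close> i.i.d. observations from the mixture, on the canonical sample space.
  Every subset of this (countable) space is measurable.\<close>

definition sample_law :: "nat \<Rightarrow> real measure \<Rightarrow> (nat \<Rightarrow> nat) measure" where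
  "sample_law n G = (\<Pi>\<^sub>M i\<in>{1..n}. density (count_space UNIV) (\<lambda>y. ennreal (mixture G y)))"

definition is_npmle :: "nat \<Rightarrow> (nat \<Rightarrow> nat) \<Rightarrow> real measure \<Rightarrow> bool" where
  "is_npmle n Y Q \<longleftrightarrow>
     is_arg_max (\<lambda>Q. \<Prod>i\<in>{1..n}. mixture Q (Y i)) (\<lambda>Q. Q \<in> prob_nonneg) Q"

definition rate :: "real \<Rightarrow> real \<Rightarrow> nat \<Rightarrow> real" where
  "rate p Mp n =
     max (real n powr (- p / (2 * p + 1)) * Mp powr (1 / (4 * p + 2))) (real n powr (- 1 / 2))
       * ln (real n) ^ 4"

end

theory Submission
  imports Defs "HOL-Complex_Analysis.Cauchy_Integral_Formula"
begin

text \<open>Truncate the data at a level \<open>K\<close> of order \<open>\<kappa>\<^sup>2 * ln n\<close>, with \<open>n * rate\<^sup>2 = \<kappa> * (ln n) ^ 8\<close>.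
  Below \<open>K\<close>, cut the mixing variable into the blocks \<open>[k\<^sup>2, (k+1)\<^sup>2]\<close>: there the Poisson weights are,
  uniformly in \<open>k\<close> and \<open>y\<close>, exponentially well approximated by their Taylor polynomials, so a mixture is
  determined up to a power of \<open>1/n\<close> by \<open>O(ln n)\<close> local moments on each of \<open>O(sqrt K)\<close> blocks. Rounding
  these moments gives a finite cover of log-cardinality \<open>O(\<kappa> * (ln n) ^ 3)\<close>.
  If the maximizer is far from the truth, then either, for some element of the cover, the (truncated)
  likelihood ratio is at least \<open>exp (- s)\<close>, or the true likelihood of the observations above \<open>K\<close> is at most
  \<open>exp (- s)\<close>. Markov's inequality for the square root of the ratio bounds the first event by the
  Hellinger affinity; for the second one it is applied to the power \<open>- 1 / (2 * ln n)\<close>, and the moment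
  assumption bounds \<open>n\<close> times the resulting tail sum by a multiple of \<open>\<kappa>\<close>.\<close>

section \<open>Local Taylor approximation of the Poisson weights\<close>

text \<open>The obstacle is heavy tails: a \<open>p\<close>-th moment allows polynomial tails of
  \<open>mixture G\<close>, and no moment bound is available for the maximizer. Above
  \<open>K\<close> the fitted mixture is therefore bounded only by 1, which costs the true
  likelihood of the large observations. Covering the rates up to \<open>4 * K\<close> takes of order
  sqrt \<open>K\<close> blocks, since a Poisson variable of rate \<theta> fluctuates on the scale
  sqrt \<theta>. With \<open>K\<close> about \<kappa>^2 this costs \<kappa>, while the expected
  number of observations above \<open>K\<close> is of order at most n * M * \<kappa>^(-2p). Equating
  the two gives \<kappa>^(2p+1) = n * M (with \<kappa> = 1 if n * M is smaller), and \<kappa> / n is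
  the squared rate up to logarithms. In the tail event a fixed power of the likelihood could make
  the tail sum diverge for small \<open>p\<close>. A power of order 1 / ln n changes it only by
  constants, because n^(1 / ln n) = e, but it puts a factor of order ln n into the denominator of
  the exponent: this is the origin of 8 ln n in the bound.\<close>

lemma power_div_fact_le_exp:
  fixes x :: real
  assumes "0 \<le> x"
  shows "x ^ y / fact y \<le> exp x"
proof -
  have s: "(\<lambda>n. x ^ n /\<^sub>R fact n) sums exp x"
    by (rule exp_converges)
  have "(\<Sum>n\<in>{y}. x ^ n /\<^sub>R fact n) \<le> exp x"
    unfolding sums_unique[OF s]
    by (rule sum_le_suminf) (use s assms in \<open>auto simp: sums_iff\<close>)
  then show ?thesis by (simp add: divide_inverse mult.commute)
qed

lemma Poi_nonneg: "0 \<le> \<theta> \<Longrightarrow> 0 \<le> Poi y \<theta>"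
  by (simp add: Poi_def)

lemma Poi_sums:
  shows "(\<lambda>y. Poi y \<theta>) sums 1"
proof -
  have "(\<lambda>y. exp (-\<theta>) * (\<theta> ^ y /\<^sub>R fact y)) sums (exp (-\<theta>) * exp \<theta>)"
    by (intro sums_mult exp_converges)
  then show ?thesis
    by (simp add: Poi_def[abs_def] exp_minus divide_inverse mult_ac)
qed

lemma Poi_sum_le_1: "0 \<le> \<theta> \<Longrightarrow> (\<Sum>y<N. Poi y \<theta>) \<le> 1"
  using Poi_sums[of \<theta>] sum_le_suminf[of "\<lambda>y. Poi y \<theta>" "{..<N}"] Poi_nonneg[of \<theta>]
  by (auto simp: sums_iff)

lemma Poi_le_1: "0 \<le> \<theta> \<Longrightarrow> Poi y \<theta> \<le> 1"
  using power_div_fact_le_exp[of \<theta> y]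
  by (simp add: Poi_def exp_minus field_simps)

lemma Poi_measurable [measurable]: "Poi y \<in> borel_measurable borel"
  unfolding Poi_def[abs_def] by measurable

text \<open>Halving the rate before comparing with the exponential series keeps half of the decay:
  the weight is at most \<open>2 ^ y * exp (- \<theta> / 2)\<close>, and
  \<open>2 ^ y \<le> exp K\<close>. Thus mixing mass beyond \<open>4 * K\<close> needs no
  cover.\<close>

lemma Poi_large_rate:
  assumes "4 * K \<le> \<theta>" "real y \<le> K"
  shows "Poi y \<theta> \<le> exp (- K)"
proof -
  have \<theta>: "0 \<le> \<theta>" using assms of_nat_0_le_iff[of y] by linarith
  have "\<theta> ^ y / fact y = 2 ^ y * ((\<theta> / 2) ^ y / fact y)"
    by (simp add: power_divide)
  also have "\<dots> \<le> 2 ^ y * exp (\<theta> / 2)"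
    using \<theta> by (intro mult_left_mono power_div_fact_le_exp) auto
  also have "(2::real) ^ y \<le> exp (real y)"
  proof -
    have "(2::real) ^ y \<le> exp 1 ^ y" by (intro power_mono) (use exp_ge_add_one_self[of 1] in auto)
    then show ?thesis by (simp add: exp_of_nat_mult[symmetric])
  qed
  finally have "\<theta> ^ y / fact y \<le> exp (real y) * exp (\<theta> / 2)" by simp
  then have "Poi y \<theta> \<le> exp (- \<theta>) * (exp (real y) * exp (\<theta> / 2))"
    unfolding Poi_def times_divide_eq_right[symmetric] by (intro mult_left_mono) auto
  also have "\<dots> = exp (real y - \<theta> / 2)" by (simp add: exp_add[symmetric])
  also have "\<dots> \<le> exp (- K)" using assms by simp
  finally show ?thesis .
qed

text \<open>Since \<open>real y ^ y / fact y \<le> exp (real y)\<close>, the weight is at most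
  \<open>(exp 1 / 8) ^ y\<close>; the factor 8 is chosen for \<open>exp 2 \<le> 8\<close>.\<close>

lemma Poi_small_rate:
  assumes "8 * \<theta> \<le> real y" "0 \<le> \<theta>"
  shows "Poi y \<theta> \<le> exp (- real y)"
proof -
  have "exp (1::real) \<le> 2.72" using e_less_272 by simp
  then have e2: "exp (2::real) \<le> 8"
  proof -
    have "exp (2::real) = exp 1 * exp 1" by (simp add: exp_add[symmetric])
    also have "\<dots> \<le> 2.72 * 2.72" using e_less_272 by (intro mult_mono) auto
    finally show ?thesis by simp
  qed
  have e2': "exp 1 / 8 \<le> exp (- 1 :: real)"
  proof -
    have "exp 1 / 8 \<le> exp 1 / exp (2::real)" using e2 by (intro divide_left_mono) auto
    also have "\<dots> = exp (-1)" by (simp add: exp_diff[symmetric])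
    finally show ?thesis .
  qed
  have "Poi y \<theta> \<le> 1 * \<theta> ^ y / fact y"
    unfolding Poi_def using assms by (intro divide_right_mono mult_right_mono) auto
  also have "\<dots> \<le> (real y / 8) ^ y / fact y"
    using assms by (simp add: divide_right_mono power_mono)
  also have "\<dots> = (1/8) ^ y * (real y ^ y / fact y)" by (simp add: power_divide)
  also have "\<dots> \<le> (1/8) ^ y * exp (real y)"
    by (intro mult_left_mono power_div_fact_le_exp) auto
  also have "\<dots> = (exp 1 / 8) ^ y" by (simp add: power_divide exp_of_nat_mult[symmetric])
  also have "\<dots> \<le> exp (-1) ^ y" by (intro power_mono e2') auto
  also have "\<dots> = exp (- real y)" by (simp add: exp_of_nat_mult[symmetric])
  finally show ?thesis .
qed

text \<open>The square-root scaling of the blocks comes from this bound: on the disc concentric with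
  \<open>[k\<^sup>2, (k+1)\<^sup>2]\<close> and of twice its width, \<open>\<bar>z\<bar> - Re z\<close> is bounded uniformly in \<open>k\<close>.\<close>

lemma norm_complex_Poi_le:
  fixes z :: complex and k :: nat
  assumes "norm (of_real (real k ^ 2 + real k + 1/2) - z) \<le> 2 * real k + 1"
  shows "norm (exp (- z) * z ^ y / fact y) \<le> exp 6"
proof -
  define c R where "c = real k ^ 2 + real k + 1/2" and "R = 2 * real k + 1"
  have n: "norm (of_real c - z) \<le> R" using assms by (simp add: c_def R_def)
  have re: "c - Re z \<le> R" using complex_Re_le_cmod[of "of_real c - z"] n by simp
  have im: "\<bar>Im z\<bar> \<le> R" using abs_Im_le_cmod[of "of_real c - z"] n by simp
  have x: "Re z \<ge> real k ^ 2 - real k - 1/2" using re by (simp add: c_def R_def)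
  have "(Im z)\<^sup>2 \<le> R\<^sup>2" using im by (rule power2_le_iff_abs_le[THEN iffD2, rotated]) (simp add: R_def)
  \<comment> \<open>As \<open>12 * x + 36 = (x + 6) ^ 2 - x ^ 2\<close>, a bound of this form is
    what yields \<open>norm z \<le> Re z + 6\<close>. It can hold for all \<open>k\<close> because
    the squared radius and the real parts on the disc both grow like \<open>k ^ 2\<close>.\<close>
  also have "R\<^sup>2 \<le> 12 * (real k ^ 2 - real k - 1/2) + 36"
  proof -
    have "0 \<le> 8 * (real k - 1)\<^sup>2 + 21" by simp
    then show ?thesis by (simp add: R_def power2_eq_square algebra_simps)
  qed
  also have "\<dots> \<le> 12 * Re z + 36" using x by simp
  finally have i: "(Im z)\<^sup>2 \<le> 12 * Re z + 36" .
  have pos: "0 \<le> Re z + 6"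
  proof -
    have "0 \<le> (real k - 1/2)\<^sup>2" by simp
    then show ?thesis using x by (simp add: power2_eq_square algebra_simps)
  qed
  have "norm z \<le> Re z + 6"
    unfolding cmod_def by (rule real_le_lsqrt) (use i pos in \<open>auto simp: power2_eq_square algebra_simps\<close>)
  then have a: "exp (- Re z + norm z) \<le> exp 6" by simp
  have "norm (exp (- z) * z ^ y / fact y) = exp (- Re z) * (norm z ^ y / fact y)"
    by (simp add: norm_mult norm_divide norm_power norm_fact)
  also have "\<dots> \<le> exp (- Re z) * exp (norm z)"
    by (intro mult_left_mono power_div_fact_le_exp) auto
  also have "\<dots> \<le> exp 6" using a by (simp only: exp_add)
  finally show ?thesis .
qed

text \<open>The affine coordinate carrying the block \<open>[k^2, (k+1)^2]\<close> onto
  \<open>[-1, 1]\<close>: the subtracted term is the centre of the block, the divisor half its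
  length.\<close>

definition block_coord :: "nat \<Rightarrow> real \<Rightarrow> real" where
  "block_coord k \<theta> = (\<theta> - (real k ^ 2 + real k + 1/2)) / (real k + 1/2)"

lemma block_coord_bound:
  assumes "real k ^ 2 \<le> \<theta>" "\<theta> \<le> (real k + 1) ^ 2"
  shows "\<bar>block_coord k \<theta>\<bar> \<le> 1"
proof -
  have "\<bar>\<theta> - (real k ^ 2 + real k + 1/2)\<bar> \<le> real k + 1/2"
    using assms by (auto simp: abs_le_iff power2_eq_square algebra_simps)
  then show ?thesis by (simp add: block_coord_def abs_divide)
qed

text \<open>Cauchy's inequality on the disc of radius \<open>2 * k + 1\<close> about the centre
  bounds the Taylor coefficients. This radius is four half-lengths over two, that is, twice the
  half-length of the block, so each degree gains a factor 1/2 in the rescaled coordinate. The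
  coefficients depend on \<open>k\<close> and \<open>y\<close> but their bounds do not, so one
  degree of order \<open>ln n\<close> serves all blocks and observations.\<close>

lemma Poi_block_expansion:
  "\<exists>b. (\<forall>d. \<bar>b d\<bar> \<le> exp 6 * (1/2) ^ d) \<and>
     (\<forall>\<theta> D. real k ^ 2 \<le> \<theta> \<longrightarrow> \<theta> \<le> (real k + 1) ^ 2 \<longrightarrow>
        \<bar>Poi y \<theta> - (\<Sum>d<D. b d * block_coord k \<theta> ^ d)\<bar> \<le> 2 * exp 6 * (1/2) ^ D)"
proof -
  define c w where "c = real k ^ 2 + real k + 1/2" and "w = real k + 1/2"
  define R where "R = 2 * real k + 1"
  define F where "F = (\<lambda>z::complex. exp (- z) * z ^ y / fact y)"
  define a where "a = (\<lambda>d. (deriv ^^ d) F (of_real c) / fact d)"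
  \<comment> \<open>Real parts turn the complex series at a real point into a real one, without a
    proof that the \<open>a d\<close> are real.\<close>
  define b where "b = (\<lambda>d. Re (a d) * w ^ d)"
  have w: "w > 0" "R = 2 * w" by (auto simp: w_def R_def)
  have hol: "F holomorphic_on A" for A
    unfolding F_def by (intro holomorphic_intros) auto
  have a_le: "norm (a d) \<le> exp 6 / R ^ d" for d
  proof -
    have "norm ((deriv ^^ d) F (of_real c)) \<le> fact d * exp 6 / R ^ d"
    proof (rule Cauchy_inequality)
      show "continuous_on (cball (of_real c) R) F" using hol holomorphic_on_imp_continuous_on by blast
      show "norm (F x) \<le> exp 6" if "norm (of_real c - x) = R" for x
        unfolding F_def by (rule norm_complex_Poi_le[of k]) (use that in \<open>simp add: c_def R_def\<close>)
    qed (use w hol in auto)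
    then show ?thesis by (simp add: a_def norm_divide norm_fact field_simps)
  qed
  have b_le: "\<bar>b d\<bar> \<le> exp 6 * (1/2) ^ d" for d
  proof -
    have "\<bar>b d\<bar> = \<bar>Re (a d)\<bar> * w ^ d" using w by (simp add: b_def abs_mult)
    also have "\<dots> \<le> exp 6 / R ^ d * w ^ d"
      using w by (intro mult_right_mono order.trans[OF abs_Re_le_cmod a_le]) auto
    also have "\<dots> = exp 6 * (1/2) ^ d" using w by (simp add: power_mult_distrib power_divide)
    finally show ?thesis .
  qed
  have ser: "(\<lambda>d. b d * block_coord k \<theta> ^ d) sums Poi y \<theta>" and u: "\<bar>block_coord k \<theta>\<bar> \<le> 1"
    if \<theta>: "real k ^ 2 \<le> \<theta>" "\<theta> \<le> (real k + 1) ^ 2" for \<theta>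
  proof -
    show u: "\<bar>block_coord k \<theta>\<bar> \<le> 1" using block_coord_bound \<theta> by blast
    have cu: "\<theta> - c = w * block_coord k \<theta>" using w by (simp add: block_coord_def c_def w_def)
    have "\<bar>\<theta> - c\<bar> \<le> w * 1" unfolding cu abs_mult using u w by (intro mult_mono) auto
    then have "of_real \<theta> \<in> ball (of_real c :: complex) R"
      using w by (simp add: dist_norm flip: of_real_diff)
    then have "(\<lambda>d. a d * (of_real \<theta> - of_real c) ^ d) sums F (of_real \<theta>)"
      unfolding a_def by (intro holomorphic_power_series[OF hol])
    from sums_Re[OF this]
    have "(\<lambda>d. Re (a d * of_real ((\<theta> - c) ^ d))) sums Re (F (of_real \<theta>))" by simp
    moreover have "Re (F (of_real \<theta>)) = Poi y \<theta>"
    proof -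
      have "F (of_real \<theta>) = of_real (Poi y \<theta>)"
        by (simp add: F_def Poi_def exp_of_real[symmetric])
      then show ?thesis by simp
    qed
    moreover have "Re (a d * of_real ((\<theta> - c) ^ d)) = b d * block_coord k \<theta> ^ d" for d
      by (simp add: b_def cu power_mult_distrib del: of_real_power)
    ultimately show "(\<lambda>d. b d * block_coord k \<theta> ^ d) sums Poi y \<theta>" by simp
  qed
  have "\<bar>Poi y \<theta> - (\<Sum>d<D. b d * block_coord k \<theta> ^ d)\<bar> \<le> 2 * exp 6 * (1/2) ^ D"
    if \<theta>: "real k ^ 2 \<le> \<theta>" "\<theta> \<le> (real k + 1) ^ 2" for \<theta> D
  proof -
    let ?g = "\<lambda>d. b d * block_coord k \<theta> ^ d"
    have g: "norm (?g d) \<le> exp 6 * (1/2) ^ d" for d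
    proof -
      have "\<bar>block_coord k \<theta>\<bar> ^ d \<le> 1" using u[OF \<theta>] by (simp add: power_le_one)
      then have "\<bar>b d\<bar> * \<bar>block_coord k \<theta>\<bar> ^ d \<le> exp 6 * (1/2) ^ d * 1"
        by (intro mult_mono b_le) auto
      then show ?thesis by (simp add: abs_mult power_abs)
    qed
    have s: "(\<lambda>d. exp 6 * (1/2 :: real) ^ (d + D)) sums (exp 6 * (1/2) ^ D * (1 / (1 - 1/2)))"
    proof -
      have "(\<lambda>d. exp 6 * (1/2) ^ D * (1/2 :: real) ^ d) sums (exp 6 * (1/2) ^ D * (1 / (1 - 1/2)))"
        by (intro sums_mult geometric_sums) simp
      then show ?thesis by (simp add: power_add mult_ac)
    qed
    have "(\<lambda>d. ?g (d + D)) sums (Poi y \<theta> - (\<Sum>d<D. ?g d))"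
      using ser[OF \<theta>] by (rule sums_split_initial_segment)
    then have "norm (Poi y \<theta> - (\<Sum>d<D. ?g d)) \<le> exp 6 * (1/2) ^ D * (1 / (1 - 1/2))"
      using norm_suminf_le[of "\<lambda>d. ?g (d + D)" "\<lambda>d. exp 6 * (1/2) ^ (d + D)"] g s
      by (auto simp: sums_iff)
    then show ?thesis by simp
  qed
  with b_le show ?thesis by blast
qed

section \<open>Poisson mixtures and their local moments\<close>

lemma prob_nonnegD:
  assumes "Q \<in> prob_nonneg"
  shows prob_space_prob_nonneg: "prob_space Q"
    and sets_prob_nonneg: "sets Q = sets (restrict_space borel {0..})"
    and space_prob_nonneg: "space Q = {0..}"
    and finite_measure_prob_nonneg: "finite_measure Q"
proof -
  show p: "prob_space Q" and s: "sets Q = sets (restrict_space borel {0..})"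
    using assms by (auto simp: prob_nonneg_def space_prob_algebra)
  show "space Q = {0..}"
    using sets_eq_imp_space_eq[OF s] by (simp add: space_restrict_space)
  show "finite_measure Q" using p by (simp add: prob_space_def)
qed

lemma borel_measurable_prob_nonneg:
  assumes "Q \<in> prob_nonneg" "f \<in> borel_measurable borel"
  shows "f \<in> borel_measurable Q"
  using measurable_restrict_space1[OF assms(2), of "{0..}"] sets_prob_nonneg[OF assms(1)]
  by (simp cong: measurable_cong_sets)

lemma integrable_bounded_prob_nonneg:
  fixes f :: "real \<Rightarrow> real"
  assumes "Q \<in> prob_nonneg" "f \<in> borel_measurable borel" "\<And>\<theta>. 0 \<le> \<theta> \<Longrightarrow> \<bar>f \<theta>\<bar> \<le> B"
  shows "integrable Q f"
proof -
  interpret finite_measure Q by (rule finite_measure_prob_nonneg) fact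
  show ?thesis
    by (rule integrable_const_bound[of _ B])
      (use assms borel_measurable_prob_nonneg in \<open>auto simp: space_prob_nonneg\<close>)
qed

lemma integral_abs_le_prob_nonneg:
  fixes f :: "real \<Rightarrow> real"
  assumes "Q \<in> prob_nonneg" "f \<in> borel_measurable borel" "\<And>\<theta>. 0 \<le> \<theta> \<Longrightarrow> \<bar>f \<theta>\<bar> \<le> B"
  shows "\<bar>\<integral>\<theta>. f \<theta> \<partial>Q\<bar> \<le> B"
proof -
  interpret prob_space Q by (rule prob_space_prob_nonneg) fact
  have i: "integrable Q f" by (rule integrable_bounded_prob_nonneg[OF assms])
  have "\<bar>\<integral>\<theta>. f \<theta> \<partial>Q\<bar> \<le> (\<integral>\<theta>. \<bar>f \<theta>\<bar> \<partial>Q)" by (rule integral_abs_bound)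
  also have "\<dots> \<le> B"
    by (rule integral_le_const) (use i assms in \<open>auto simp: space_prob_nonneg\<close>)
  finally show ?thesis .
qed

lemma integrable_Poi: "Q \<in> prob_nonneg \<Longrightarrow> integrable Q (Poi y)"
  by (rule integrable_bounded_prob_nonneg[of _ _ 1]) (auto simp: Poi_nonneg Poi_le_1)

lemma mixture_nonneg: "Q \<in> prob_nonneg \<Longrightarrow> 0 \<le> mixture Q y"
  unfolding mixture_def
  by (rule Bochner_Integration.integral_nonneg) (auto simp: space_prob_nonneg Poi_nonneg)

lemma mixture_le_1: "Q \<in> prob_nonneg \<Longrightarrow> mixture Q y \<le> 1"
  using integral_abs_le_prob_nonneg[of Q "Poi y" 1] mixture_nonneg[of Q y]
  by (auto simp: Poi_nonneg Poi_le_1 mixture_def)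

lemma mixture_sums:
  assumes Q: "Q \<in> prob_nonneg"
  shows "mixture Q sums 1"
proof -
  interpret prob_space Q by (rule prob_space_prob_nonneg) fact
  have s: "summable (\<lambda>y. norm (Poi y \<theta>))" if "0 \<le> \<theta>" for \<theta>
    using Poi_sums[of \<theta>] that by (simp add: sums_iff Poi_nonneg)
  have n: "(\<integral>\<theta>. norm (Poi y \<theta>) \<partial>Q) = mixture Q y" for y
    unfolding mixture_def
    by (rule Bochner_Integration.integral_cong) (auto simp: space_prob_nonneg[OF Q] Poi_nonneg)
  have p: "(\<Sum>y<N. mixture Q y) \<le> 1" for N
  proof -
    have "(\<Sum>y<N. mixture Q y) = (\<integral>\<theta>. (\<Sum>y<N. Poi y \<theta>) \<partial>Q)"
      unfolding mixture_def by (rule Bochner_Integration.integral_sum[symmetric]) (rule integrable_Poi[OF Q])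
    also have "\<bar>\<dots>\<bar> \<le> 1"
      by (rule integral_abs_le_prob_nonneg[OF Q]) (auto simp: Poi_sum_le_1 sum_nonneg Poi_nonneg)
    finally show ?thesis by simp
  qed
  have sm: "summable (mixture Q)"
    by (rule summableI_nonneg_bounded[of _ 1]) (auto simp: mixture_nonneg[OF Q] p)
  have "(\<lambda>y. integral\<^sup>L Q (Poi y)) sums (\<integral>\<theta>. (\<Sum>y. Poi y \<theta>) \<partial>Q)"
    by (rule sums_integral) (use s sm in \<open>auto simp: integrable_Poi[OF Q] space_prob_nonneg[OF Q] n simp del: real_norm_def\<close>)
  moreover have "(\<integral>\<theta>. (\<Sum>y. Poi y \<theta>) \<partial>Q) = 1"
    using sums_unique[OF Poi_sums, symmetric] by (simp add: prob_space)
  ultimately show ?thesis by (simp add: mixture_def[abs_def])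
qed

text \<open>The blocks are half-open, so those with \<open>k < B\<close> partition
  \<open>[0, B^2)\<close> and no rate is counted twice. In the rescaled coordinate all moments lie
  in \<open>[-1, 1]\<close>, so one rounding mesh serves every block and degree.\<close>

definition block_moment :: "real measure \<Rightarrow> nat \<Rightarrow> nat \<Rightarrow> real" where
  "block_moment Q k d =
     (\<integral>\<theta>. indicator {real k ^ 2..<(real k + 1) ^ 2} \<theta> * block_coord k \<theta> ^ d \<partial>Q)"

lemma block_integrand_bound:
  "\<bar>indicator {real k ^ 2..<(real k + 1) ^ 2} \<theta> * block_coord k \<theta> ^ d\<bar> \<le> (1::real)"
  using block_coord_bound[of k \<theta>]
  by (auto simp: indicator_def power_abs power_le_one)

lemma block_coord_measurable [measurable]: "block_coord k \<in> borel_measurable borel"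
  unfolding block_coord_def[abs_def] by measurable

lemma block_moment_bound: "Q \<in> prob_nonneg \<Longrightarrow> \<bar>block_moment Q k d\<bar> \<le> 1"
  unfolding block_moment_def
  by (rule integral_abs_le_prob_nonneg) (auto simp: block_integrand_bound)

lemma ex_block:
  fixes \<theta> :: real
  assumes "0 \<le> \<theta>" "\<theta> < real B ^ 2"
  obtains k where "k < B" "real k ^ 2 \<le> \<theta>" "\<theta> < (real k + 1) ^ 2"
proof
  define k where "k = nat \<lfloor>sqrt \<theta>\<rfloor>"
  have s: "0 \<le> sqrt \<theta>" using assms by simp
  have k: "real k \<le> sqrt \<theta>" "sqrt \<theta> < real k + 1" using s by (auto simp: k_def) 
  have "sqrt \<theta> < real B" using assms by (simp add: real_less_lsqrt)
  then show "k < B" using k by simp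
  show "real k ^ 2 \<le> \<theta>" using power_mono[OF k(1), of 2] assms by simp
  show "\<theta> < (real k + 1) ^ 2" using power_strict_mono[OF k(2), of 2] assms by simp
qed

text \<open>\<open>Poi y\<close> is within \<open>\<rho>\<close> of a function \<open>P\<close> that
  is polynomial on each block below \<open>B^2\<close> and zero beyond, uniformly over nonnegative
  rates, and the integral of \<open>P\<close> is linear in the local moments. Each of the two
  measures pays \<open>\<rho>\<close> once. On each block the moment differences are weighted by
  coefficients whose absolute values sum to at most \<open>2 * exp 6\<close>, whatever the
  degree.\<close>

lemma mixture_close:
  assumes Q: "Q \<in> prob_nonneg" and Q': "Q' \<in> prob_nonneg"
    and cl: "\<And>k d. k < B \<Longrightarrow> d < D \<Longrightarrow> \<bar>block_moment Q k d - block_moment Q' k d\<bar> \<le> \<delta>"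
    and y: "real y \<le> K" and B: "4 * K \<le> real B ^ 2" and \<delta>: "0 \<le> \<delta>"
  shows "\<bar>mixture Q y - mixture Q' y\<bar>
    \<le> 2 * (2 * exp 6 * (1/2) ^ D + exp (- K)) + 2 * exp 6 * real B * \<delta>"
proof -
  have "\<forall>k. \<exists>b. (\<forall>d. \<bar>b d\<bar> \<le> exp 6 * (1/2) ^ d) \<and>
     (\<forall>\<theta> D. real k ^ 2 \<le> \<theta> \<longrightarrow> \<theta> \<le> (real k + 1) ^ 2 \<longrightarrow>
        \<bar>Poi y \<theta> - (\<Sum>d<D. b d * block_coord k \<theta> ^ d)\<bar> \<le> 2 * exp 6 * (1/2) ^ D)"
    using Poi_block_expansion by blast
  then obtain b where "\<forall>k. (\<forall>d. \<bar>b k d\<bar> \<le> exp 6 * (1/2) ^ d) \<and>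
     (\<forall>\<theta> D. real k ^ 2 \<le> \<theta> \<longrightarrow> \<theta> \<le> (real k + 1) ^ 2 \<longrightarrow>
        \<bar>Poi y \<theta> - (\<Sum>d<D. b k d * block_coord k \<theta> ^ d)\<bar> \<le> 2 * exp 6 * (1/2) ^ D)"
    unfolding choice_iff by blast
  then have b: "\<And>k d. \<bar>b k d\<bar> \<le> exp 6 * (1/2) ^ d"
    and app: "\<And>k \<theta>. real k ^ 2 \<le> \<theta> \<Longrightarrow> \<theta> \<le> (real k + 1) ^ 2 \<Longrightarrow>
        \<bar>Poi y \<theta> - (\<Sum>d<D. b k d * block_coord k \<theta> ^ d)\<bar> \<le> 2 * exp 6 * (1/2) ^ D"
    by auto
  define I where "I = (\<lambda>k \<theta>. indicator {real k ^ 2..<(real k + 1) ^ 2} \<theta> :: real)"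
  define P where "P = (\<lambda>\<theta>. \<Sum>k<B. \<Sum>d<D. b k d * (I k \<theta> * block_coord k \<theta> ^ d))"
  define \<rho> where "\<rho> = 2 * exp 6 * (1/2) ^ D + exp (- K)"
  have [measurable]: "I k \<in> borel_measurable borel" for k unfolding I_def by measurable
  have [measurable]: "P \<in> borel_measurable borel" unfolding P_def by measurable
  have r: "\<bar>Poi y \<theta> - P \<theta>\<bar> \<le> \<rho>" if \<theta>: "0 \<le> \<theta>" for \<theta>
  proof (cases "\<theta> < real B ^ 2")
    case True
    then obtain k where k: "k < B" "real k ^ 2 \<le> \<theta>" "\<theta> < (real k + 1) ^ 2"
      using ex_block \<theta> by blast
    have other: "I j \<theta> = 0" if "j \<noteq> k" for j
    proof (rule ccontr)
      assume "I j \<theta> \<noteq> 0"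
      then have j: "real j ^ 2 \<le> \<theta>" "\<theta> < (real j + 1) ^ 2" by (auto simp: I_def indicator_def split: if_splits)
      have "real j < real k + 1"
        by (rule power_less_imp_less_base[of _ 2]) (use j k in auto)
      moreover have "real k < real j + 1"
        by (rule power_less_imp_less_base[of _ 2]) (use j k in auto)
      ultimately show False using that by simp
    qed
    have "P \<theta> = (\<Sum>j<B. if j = k then \<Sum>d<D. b k d * block_coord k \<theta> ^ d else 0)"
      unfolding P_def using k by (intro sum.cong) (auto simp: other, auto simp: I_def)
    also have "\<dots> = (\<Sum>d<D. b k d * block_coord k \<theta> ^ d)" using k by simp
    finally show ?thesis using app[of k \<theta>] k by (auto simp: \<rho>_def intro: add_increasing2)
  next
    case False
    have "P \<theta> = 0" unfolding P_def
    proof (intro sum.neutral ballI)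
      fix k d assume "k \<in> {..<B}" "d \<in> {..<D}"
      then have "(real k + 1) ^ 2 \<le> real B ^ 2" by (intro power_mono) auto
      then have "\<not> \<theta> < (real k + 1) ^ 2" using False by linarith
      then have "I k \<theta> = 0" by (simp add: I_def)
      then show "b k d * (I k \<theta> * block_coord k \<theta> ^ d) = 0" by simp
    qed
    moreover have "Poi y \<theta> \<le> exp (- K)"
      by (rule Poi_large_rate) (use False B y in auto)
    moreover have "0 \<le> 2 * exp 6 * (1/2 :: real) ^ D" by simp
    ultimately show ?thesis using Poi_nonneg[OF \<theta>, of y] by (auto simp: \<rho>_def intro: add_increasing)
  qed
  have PQ: "(\<integral>\<theta>. P \<theta> \<partial>Q) = (\<Sum>k<B. \<Sum>d<D. b k d * block_moment Q k d)"
    and iP: "integrable Q P" if Q: "Q \<in> prob_nonneg" for Q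
  proof -
    have i: "integrable Q (\<lambda>\<theta>. I k \<theta> * block_coord k \<theta> ^ d)" for k d
      by (rule integrable_bounded_prob_nonneg[OF Q, of _ 1]) (auto simp: I_def block_integrand_bound)
    show "integrable Q P" unfolding P_def
      by (intro Bochner_Integration.integrable_sum integrable_mult_right i)
    have "block_moment Q k d = (\<integral>\<theta>. I k \<theta> * block_coord k \<theta> ^ d \<partial>Q)" for k d
      by (simp add: block_moment_def I_def)
    then show "(\<integral>\<theta>. P \<theta> \<partial>Q) = (\<Sum>k<B. \<Sum>d<D. b k d * block_moment Q k d)"
      unfolding P_def using i by (simp add: Bochner_Integration.integral_sum)
  qed
  have d: "\<bar>mixture Q y - (\<Sum>k<B. \<Sum>d<D. b k d * block_moment Q k d)\<bar> \<le> \<rho>" if Q: "Q \<in> prob_nonneg" for Q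
  proof -
    have "mixture Q y - (\<Sum>k<B. \<Sum>d<D. b k d * block_moment Q k d) = (\<integral>\<theta>. Poi y \<theta> - P \<theta> \<partial>Q)"
      unfolding mixture_def PQ[OF Q, symmetric]
      by (rule Bochner_Integration.integral_diff[symmetric]) (use iP integrable_Poi Q in auto)
    also have "\<bar>\<dots>\<bar> \<le> \<rho>" by (rule integral_abs_le_prob_nonneg[OF Q _ r]) auto
    finally show ?thesis .
  qed
  have "\<bar>(\<Sum>k<B. \<Sum>d<D. b k d * block_moment Q k d) - (\<Sum>k<B. \<Sum>d<D. b k d * block_moment Q' k d)\<bar>
      = \<bar>\<Sum>k<B. \<Sum>d<D. b k d * (block_moment Q k d - block_moment Q' k d)\<bar>"
    by (simp add: sum_subtractf right_diff_distrib)
  also have "\<dots> \<le> (\<Sum>k<B. \<Sum>d<D. \<bar>b k d * (block_moment Q k d - block_moment Q' k d)\<bar>)"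
    by (intro order.trans[OF sum_abs] sum_mono order.refl)
  also have "\<dots> \<le> (\<Sum>k<B. \<Sum>d<D. exp 6 * (1/2) ^ d * \<delta>)"
  proof (rule sum_mono, rule sum_mono)
    fix k d assume "k \<in> {..<B}" "d \<in> {..<D}"
    then have "\<bar>block_moment Q k d - block_moment Q' k d\<bar> \<le> \<delta>" using cl by simp
    then show "\<bar>b k d * (block_moment Q k d - block_moment Q' k d)\<bar> \<le> exp 6 * (1/2) ^ d * \<delta>"
      unfolding abs_mult using b[of k d] by (intro mult_mono) auto
  qed
  also have "\<dots> = real B * ((\<Sum>d<D. exp 6 * (1/2) ^ d) * \<delta>)"
    by (simp only: sum_distrib_right[symmetric] sum_constant card_lessThan)
  also have "(\<Sum>d<D. exp 6 * (1/2) ^ d) * \<delta> = exp 6 * \<delta> * (\<Sum>d<D. (1/2) ^ d)"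
    by (simp only: sum_distrib_left[symmetric] mult_ac)
  also have "real B * (exp 6 * \<delta> * (\<Sum>d<D. (1/2) ^ d)) \<le> real B * (exp 6 * \<delta> * 2)"
    using \<delta> by (intro mult_left_mono) (auto simp: geometric_sum)
  finally show ?thesis using d[OF Q] d[OF Q'] unfolding \<rho>_def by (simp add: mult_ac)
qed

text \<open>Each of the \<open>B * D\<close> moments is rounded down to a grid of mesh
  \<open>\<delta>\<close>. The cover is given as a labelling instead of a list of centres, so that a
  representative of a cell can later be chosen inside any subset that the cell meets.\<close>

lemma moment_partition:
  assumes "0 < \<delta>"
  obtains \<Phi> :: "real measure \<Rightarrow> nat \<times> nat \<Rightarrow> int"
  where "finite (\<Phi> ` prob_nonneg)" "real (card (\<Phi> ` prob_nonneg)) \<le> (2 / \<delta> + 3) ^ (B * D)"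
    "\<And>Q Q' k d. \<Phi> Q = \<Phi> Q' \<Longrightarrow> k < B \<Longrightarrow> d < D \<Longrightarrow>
       \<bar>block_moment Q k d - block_moment Q' k d\<bar> \<le> \<delta>"
proof
  define S where "S = {..<B} \<times> {..<D}"
  define T where "T = {\<lfloor>- (1/\<delta>)\<rfloor>..\<lfloor>1/\<delta>\<rfloor>}"
  \<comment> \<open>Restriction to \<open>S\<close> fixes the label outside the finite index set,
    which places the image in a finite \<open>PiE\<close>.\<close>
  define \<Phi> where "\<Phi> = (\<lambda>Q. restrict (\<lambda>(k, d). \<lfloor>block_moment Q k d / \<delta>\<rfloor>) S)"
  have sub: "\<Phi> ` prob_nonneg \<subseteq> PiE S (\<lambda>_. T)"
  proof -
    have "\<lfloor>block_moment Q k d / \<delta>\<rfloor> \<in> T" if "Q \<in> prob_nonneg" for Q k d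
    proof -
      have "- 1 \<le> block_moment Q k d" "block_moment Q k d \<le> 1"
        using block_moment_bound[OF that, of k d] by auto
      then have "- (1/\<delta>) \<le> block_moment Q k d / \<delta>" "block_moment Q k d / \<delta> \<le> 1 / \<delta>"
        using assms by (auto simp: field_simps)
      then show ?thesis unfolding T_def by (auto intro: floor_mono)
    qed
    then show ?thesis unfolding \<Phi>_def by auto
  qed
  have fin: "finite (PiE S (\<lambda>_. T))" unfolding S_def T_def by (intro finite_PiE) auto
  show "finite (\<Phi> ` prob_nonneg)" using sub fin by (rule finite_subset)
  have "card (\<Phi> ` prob_nonneg) \<le> card T ^ (B * D)"
    using card_mono[OF fin sub] by (simp add: card_PiE S_def)
  then have "real (card (\<Phi> ` prob_nonneg)) \<le> real (card T) ^ (B * D)"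
    by (metis of_nat_le_iff of_nat_power)
  also have "\<dots> \<le> (2 / \<delta> + 3) ^ (B * D)"
  proof (rule power_mono)
    have "\<lfloor>- (1/\<delta>)\<rfloor> \<le> \<lfloor>1/\<delta>\<rfloor>" using assms by (intro floor_mono) (simp add: order.trans[of _ 0])
    then have "real (card T) = of_int (\<lfloor>1/\<delta>\<rfloor> - \<lfloor>- (1/\<delta>)\<rfloor> + 1)" by (simp add: T_def)
    also have "\<dots> \<le> 2 / \<delta> + 3" by linarith
    finally show "real (card T) \<le> 2 / \<delta> + 3" .
  qed auto
  finally show "real (card (\<Phi> ` prob_nonneg)) \<le> (2 / \<delta> + 3) ^ (B * D)" .
  fix Q Q' k d assume "\<Phi> Q = \<Phi> Q'" "k < B" "d < D"
  then have "\<lfloor>block_moment Q k d / \<delta>\<rfloor> = \<lfloor>block_moment Q' k d / \<delta>\<rfloor>"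
    by (auto simp: \<Phi>_def S_def dest: fun_cong[of _ _ "(k, d)"])
  then have "\<bar>block_moment Q k d / \<delta> - block_moment Q' k d / \<delta>\<bar> \<le> 1" by linarith
  then show "\<bar>block_moment Q k d - block_moment Q' k d\<bar> \<le> \<delta>"
    using assms by (simp add: field_simps abs_le_iff)
qed

section \<open>Product laws on the sample space\<close>

text \<open>\<open>k\<close> need not sum to one: such unnormalised product measures serve as
  dominating measures, of total mass \<open>(\<Sum>y. k y) ^ n\<close>.\<close>

definition iid_law :: "nat \<Rightarrow> (nat \<Rightarrow> real) \<Rightarrow> (nat \<Rightarrow> nat) measure" where
  "iid_law n k = (\<Pi>\<^sub>M i\<in>{1..n}. density (count_space UNIV) (\<lambda>y. ennreal (k y)))"

lemma sample_law_eq: "sample_law n G = iid_law n (mixture G)"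
  by (simp add: sample_law_def iid_law_def)

lemma space_iid_law: "space (iid_law n k) = PiE {1..n} (\<lambda>_. UNIV)"
  by (simp add: iid_law_def space_PiM)

lemma singleton_iid_law:
  assumes "Y \<in> space (iid_law n k)"
  shows "{Y} = PiE {1..n} (\<lambda>i. {Y i})"
  using assms PiE_singleton[of Y "{1..n}"] by (simp add: space_iid_law PiE_def)

text \<open>The space is countable and each singleton is a box. Hence every event about the
  arbitrary selection \<open>Ghat\<close> is measurable.\<close>

lemma sets_iid_law: "sets (iid_law n k) = Pow (space (iid_law n k))"
proof
  show "sets (iid_law n k) \<subseteq> Pow (space (iid_law n k))" using sets.space_closed by blast
  have "E \<in> sets (iid_law n k)" if "E \<subseteq> space (iid_law n k)" for E
  proof (rule sets.countable[OF _ countable_subset[OF that]])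
    fix Y assume "Y \<in> E"
    then have "{Y} = PiE {1..n} (\<lambda>i. {Y i})" using singleton_iid_law that by blast
    also have "\<dots> \<in> sets (iid_law n k)" unfolding iid_law_def by (intro sets_PiM_I_finite) auto
    finally show "{Y} \<in> sets (iid_law n k)" .
  next
    show "countable (space (iid_law n k))" unfolding space_iid_law by (intro countable_PiE) auto
  qed
  then show "Pow (space (iid_law n k)) \<subseteq> sets (iid_law n k)" by blast
qed

lemma product_sigma_finite_density:
  fixes k :: "nat \<Rightarrow> real"
  shows "product_sigma_finite (\<lambda>i::nat. density (count_space UNIV) (\<lambda>y. ennreal (k y)))"
proof -
  have "sigma_finite_measure (density (count_space UNIV) (\<lambda>y. ennreal (k y)))"
    by (subst sigma_finite_measure.sigma_finite_iff_density_finite)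
      (auto intro: sigma_finite_measure_count_space)
  then show ?thesis by (simp add: product_sigma_finite_def)
qed

lemma emeasure_iid_law_singleton:
  assumes "Y \<in> space (iid_law n k)" "\<And>y. 0 \<le> k y"
  shows "emeasure (iid_law n k) {Y} = ennreal (\<Prod>i\<in>{1..n}. k (Y i))"
proof -
  interpret product_sigma_finite "\<lambda>i::nat. density (count_space UNIV) (\<lambda>y. ennreal (k y))"
    by (rule product_sigma_finite_density)
  have "emeasure (iid_law n k) {Y}
      = (\<Prod>i\<in>{1..n}. emeasure (density (count_space UNIV) (\<lambda>y. ennreal (k y))) {Y i})"
    unfolding singleton_iid_law[OF assms(1)] unfolding iid_law_def by (intro emeasure_PiM) auto
  also have "\<dots> = (\<Prod>i\<in>{1..n}. ennreal (k (Y i)))"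
    by (intro prod.cong refl) (simp add: emeasure_density nn_integral_count_space_indicator[symmetric] nn_integral_count_space_finite)
  also have "\<dots> = ennreal (\<Prod>i\<in>{1..n}. k (Y i))" by (rule prod_ennreal) (use assms in auto)
  finally show ?thesis .
qed

lemma emeasure_iid_law_space:
  assumes "summable k" "\<And>y. 0 \<le> k y"
  shows "emeasure (iid_law n k) (space (iid_law n k)) = ennreal ((\<Sum>y. k y) ^ n)"
proof -
  interpret product_sigma_finite "\<lambda>i::nat. density (count_space UNIV) (\<lambda>y. ennreal (k y))"
    by (rule product_sigma_finite_density)
  have "emeasure (density (count_space UNIV) (\<lambda>y. ennreal (k y))) UNIV = (\<Sum>y. ennreal (k y))"
    by (simp add: emeasure_density nn_integral_count_space_nat)
  also have "\<dots> = ennreal (\<Sum>y. k y)" by (rule suminf_ennreal2) (use assms in auto)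
  finally have e: "emeasure (density (count_space UNIV) (\<lambda>y. ennreal (k y))) UNIV = ennreal (\<Sum>y. k y)" .
  have "emeasure (iid_law n k) (space (iid_law n k))
      = (\<Prod>i\<in>{1..n}. emeasure (density (count_space UNIV) (\<lambda>y. ennreal (k y))) UNIV)"
    unfolding space_iid_law unfolding iid_law_def by (intro emeasure_PiM) auto
  then show ?thesis unfolding e using assms by (simp add: ennreal_power suminf_nonneg)
qed

text \<open>Markov's inequality in atomic form: sum the pointwise domination over \<open>E\<close>,
  then enlarge \<open>E\<close> to the whole space, where the mass of the dominating product
  factorizes. Taking \<open>k\<close> to be the geometric mean of two likelihoods gives the bound by
  the Hellinger affinity.\<close>

lemma emeasure_iid_law_le:
  assumes f: "\<And>y. 0 \<le> f y" and k: "summable k" "\<And>y. 0 \<le> k y" and c: "0 \<le> c"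
    and E: "E \<subseteq> space (iid_law n f)"
    and le: "\<And>Y. Y \<in> E \<Longrightarrow> (\<Prod>i\<in>{1..n}. f (Y i)) \<le> c * (\<Prod>i\<in>{1..n}. k (Y i))"
  shows "emeasure (iid_law n f) E \<le> ennreal (c * (\<Sum>y. k y) ^ n)"
proof -
  have E': "E \<subseteq> space (iid_law n k)" using E by (simp add: space_iid_law)
  have cE: "countable E"
    by (rule countable_subset[OF E]) (auto simp: space_iid_law intro!: countable_PiE)
  have "emeasure (iid_law n f) E = (\<integral>\<^sup>+Y. emeasure (iid_law n f) {Y} \<partial>count_space E)"
    by (rule emeasure_countable_singleton[OF _ cE]) (use E in \<open>auto simp: sets_iid_law\<close>)
  also have "\<dots> \<le> (\<integral>\<^sup>+Y. ennreal c * emeasure (iid_law n k) {Y} \<partial>count_space E)"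
  proof (rule nn_integral_mono)
    fix Y assume "Y \<in> space (count_space E)"
    then have Y: "Y \<in> E" by simp
    have "emeasure (iid_law n f) {Y} = ennreal (\<Prod>i\<in>{1..n}. f (Y i))"
      by (rule emeasure_iid_law_singleton) (use Y E f in auto)
    also have "\<dots> \<le> ennreal (c * (\<Prod>i\<in>{1..n}. k (Y i)))" by (rule ennreal_leI) (rule le[OF Y])
    also have "\<dots> = ennreal c * ennreal (\<Prod>i\<in>{1..n}. k (Y i))" using c k by (simp add: ennreal_mult prod_nonneg)
    also have "ennreal (\<Prod>i\<in>{1..n}. k (Y i)) = emeasure (iid_law n k) {Y}"
      by (rule emeasure_iid_law_singleton[symmetric]) (use Y E' k in auto)
    finally show "emeasure (iid_law n f) {Y} \<le> ennreal c * emeasure (iid_law n k) {Y}" .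
  qed
  also have "\<dots> = ennreal c * (\<integral>\<^sup>+Y. emeasure (iid_law n k) {Y} \<partial>count_space E)"
    by (rule nn_integral_cmult) auto
  also have "(\<integral>\<^sup>+Y. emeasure (iid_law n k) {Y} \<partial>count_space E) = emeasure (iid_law n k) E"
    by (rule emeasure_countable_singleton[OF _ cE, symmetric]) (use E' in \<open>auto simp: sets_iid_law\<close>)
  also have "ennreal c * emeasure (iid_law n k) E \<le> ennreal c * emeasure (iid_law n k) (space (iid_law n k))"
    by (intro mult_left_mono emeasure_space) auto
  also have "\<dots> = ennreal (c * (\<Sum>y. k y) ^ n)"
    using c k by (simp add: emeasure_iid_law_space ennreal_mult suminf_nonneg)
  finally show ?thesis .
qed

lemma prob_space_sample_law:
  assumes "G \<in> prob_nonneg"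
  shows "prob_space (sample_law n G)"
  by (rule prob_spaceI)
    (use mixture_sums[OF assms] mixture_nonneg[OF assms] in
      \<open>simp add: sample_law_eq emeasure_iid_law_space sums_iff\<close>)

lemma measure_sample_law_le:
  assumes G: "G \<in> prob_nonneg" and k: "summable k" "\<And>y. 0 \<le> k y" and c: "0 \<le> c"
    and E: "E \<subseteq> space (sample_law n G)"
    and le: "\<And>Y. Y \<in> E \<Longrightarrow> (\<Prod>i\<in>{1..n}. mixture G (Y i)) \<le> c * (\<Prod>i\<in>{1..n}. k (Y i))"
  shows "measure (sample_law n G) E \<le> c * (\<Sum>y. k y) ^ n"
proof -
  have "emeasure (sample_law n G) E \<le> ennreal (c * (\<Sum>y. k y) ^ n)"
    unfolding sample_law_eq
    by (rule emeasure_iid_law_le) (use assms mixture_nonneg[OF G] in \<open>auto simp: sample_law_eq\<close>)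
  then show ?thesis
    unfolding measure_def using c k by (intro enn2real_leI) (auto simp: suminf_nonneg)
qed

section \<open>Hellinger distance and tail sums\<close>

lemma hellinger_sq_pmf:
  assumes f: "f sums 1" "\<And>y. 0 \<le> f y" and g: "g sums 1" "\<And>y. 0 \<le> g y"
  shows summable_sqrt_mult: "summable (\<lambda>y. sqrt (f y * g y))"
    and hellinger_sq_eq: "hellinger_sq f g = 2 - 2 * (\<Sum>y. sqrt (f y * g y))"
    and hellinger_sq_nonneg: "0 \<le> hellinger_sq f g"
    and hellinger_sq_le_2: "hellinger_sq f g \<le> 2"
proof -
  have fg: "(\<lambda>y. f y + g y) sums 2" using sums_add[OF f(1) g(1)] by simp
  have am: "sqrt (f y * g y) \<le> f y + g y" for y
    using arith_geo_mean_sqrt[OF f(2) g(2), of y y] f(2)[of y] g(2)[of y] by (simp add: field_simps)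
  show s: "summable (\<lambda>y. sqrt (f y * g y))"
    by (rule summable_comparison_test'[of "\<lambda>y. f y + g y" 0])
      (use fg am f g in \<open>auto simp: sums_iff\<close>)
  have sq: "(sqrt (f y) - sqrt (g y))\<^sup>2 = (f y + g y) - 2 * sqrt (f y * g y)" for y
    using f(2)[of y] g(2)[of y] by (simp add: power2_diff real_sqrt_mult)
  have sq_sums: "(\<lambda>y. (sqrt (f y) - sqrt (g y))\<^sup>2) sums (2 - 2 * (\<Sum>y. sqrt (f y * g y)))"
    unfolding sq by (intro sums_diff fg sums_mult summable_sums s)
  from this show e: "hellinger_sq f g = 2 - 2 * (\<Sum>y. sqrt (f y * g y))"
    by (simp add: hellinger_sq_def sums_iff)
  show "0 \<le> hellinger_sq f g"
    unfolding hellinger_sq_def by (rule suminf_nonneg) (use sq_sums in \<open>auto simp: sums_iff\<close>)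
  have "0 \<le> (\<Sum>y. sqrt (f y * g y))" by (rule suminf_nonneg[OF s]) (use f g in auto)
  then show "hellinger_sq f g \<le> 2" unfolding e by simp
qed

lemma hellinger_le_sqrt2:
  assumes "P \<in> prob_nonneg" "Q \<in> prob_nonneg"
  shows "hellinger (mixture P) (mixture Q) \<le> sqrt 2"
  unfolding hellinger_def
  using hellinger_sq_le_2[OF mixture_sums[OF assms(1)] mixture_nonneg[OF assms(1)]
      mixture_sums[OF assms(2)] mixture_nonneg[OF assms(2)]] by simp

section \<open>Tail sums of a mixture under the moment condition\<close>

lemma moment_integrable:
  assumes G: "G \<in> prob_nonneg" and m: "moment p G \<le> ennreal M" and M: "0 \<le> M"
  shows "integrable G (\<lambda>\<theta>. \<theta> powr p)" "(\<integral>\<theta>. \<theta> powr p \<partial>G) \<le> M"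
proof -
  have m': "(\<integral>\<^sup>+u. ennreal (u powr p) \<partial>G) \<le> ennreal M" using m by (simp add: moment_def)
  have meas: "(\<lambda>\<theta>. \<theta> powr p) \<in> borel_measurable G"
    by (rule borel_measurable_prob_nonneg[OF G]) measurable
  show i: "integrable G (\<lambda>\<theta>. \<theta> powr p)"
    by (rule integrableI_bounded[OF meas]) (use m' in \<open>auto simp: order.strict_trans1[OF m']\<close>)
  have "ennreal (\<integral>\<theta>. \<theta> powr p \<partial>G) \<le> ennreal M"
    using m' by (subst nn_integral_eq_integral[symmetric]) (use i in auto)
  then show "(\<integral>\<theta>. \<theta> powr p \<partial>G) \<le> M" using M by (simp add: ennreal_le_iff)
qed

text \<open>\<open>a\<close> is the mixture for the unnormalised mixing measure with density
  \<open>\<theta> powr p\<close> with respect to \<open>G\<close>. Poisson weights sum to one, so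
  its total mass is the \<open>p\<close>-th moment of \<open>G\<close>.\<close>

lemma size_biased_mixture_sum:
  assumes G: "G \<in> prob_nonneg" and m: "moment p G \<le> ennreal M" and M: "0 \<le> M"
  defines "a \<equiv> \<lambda>y. \<integral>\<theta>. \<theta> powr p * Poi y \<theta> \<partial>G"
  shows "integrable G (\<lambda>\<theta>. \<theta> powr p * Poi y \<theta>)" "0 \<le> a y" "summable a" "(\<Sum>y. a y) \<le> M"
proof -
  note mi = moment_integrable[OF G m M]
  show i: "integrable G (\<lambda>\<theta>. \<theta> powr p * Poi y \<theta>)" for y
  proof (rule Bochner_Integration.integrable_bound[OF mi(1)])
    show "(\<lambda>\<theta>. \<theta> powr p * Poi y \<theta>) \<in> borel_measurable G"
      by (rule borel_measurable_prob_nonneg[OF G]) measurable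
    show "AE \<theta> in G. norm (\<theta> powr p * Poi y \<theta>) \<le> norm (\<theta> powr p)"
      by (rule AE_I2) (auto simp: space_prob_nonneg[OF G] Poi_nonneg Poi_le_1 abs_mult intro!: mult_left_le)
  qed
  show nn: "0 \<le> a y" for y unfolding a_def
    by (rule Bochner_Integration.integral_nonneg) (auto simp: space_prob_nonneg[OF G] Poi_nonneg)
  have le: "(\<Sum>y<N. a y) \<le> M" for N
  proof -
    have "(\<Sum>y<N. a y) = (\<integral>\<theta>. (\<Sum>y<N. \<theta> powr p * Poi y \<theta>) \<partial>G)"
      unfolding a_def by (rule Bochner_Integration.integral_sum[symmetric]) (rule i)
    also have "\<dots> \<le> (\<integral>\<theta>. \<theta> powr p \<partial>G)"
    proof (rule integral_mono)
      show "integrable G (\<lambda>\<theta>. \<Sum>y<N. \<theta> powr p * Poi y \<theta>)" using i by (intro Bochner_Integration.integrable_sum)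
      fix \<theta> assume "\<theta> \<in> space G"
      then show "(\<Sum>y<N. \<theta> powr p * Poi y \<theta>) \<le> \<theta> powr p"
        unfolding sum_distrib_left[symmetric]
        by (intro mult_left_le Poi_sum_le_1) (auto simp: space_prob_nonneg[OF G])
    qed (rule mi)
    finally show ?thesis using mi(2) by simp
  qed
  show s: "summable a" by (rule summableI_nonneg_bounded[of _ M]) (use nn le in auto)
  show "(\<Sum>y. a y) \<le> M" by (rule suminf_le_const[OF s le])
qed

lemma summable_n_exp: "summable (\<lambda>y. real y * exp (- real y / 2))"
proof (rule summable_comparison_test'[of "\<lambda>y. 4 * exp (-1/4 :: real) ^ y" 0])
  show "summable (\<lambda>y. 4 * exp (-1/4 :: real) ^ y)" by (intro summable_mult summable_geometric) simp
  fix y :: nat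
  have "real y / 4 \<le> exp (real y / 4)" using exp_ge_add_one_self[of "real y / 4"] by linarith
  then have "real y * exp (- real y / 2) \<le> 4 * exp (real y / 4) * exp (- real y / 2)"
    by (intro mult_right_mono) auto
  also have "\<dots> = 4 * exp (-1/4) ^ y" by (simp add: exp_add[symmetric] exp_of_nat_mult[symmetric])
  finally show "norm (real y * exp (- real y / 2)) \<le> 4 * exp (-1/4) ^ y" by simp
qed

text \<open>An observation \<open>y\<close> above \<open>K\<close> either exceeds 8 times its rate,
  which has exponentially small weight, or forces the rate above \<open>y / 8\<close>; the second
  case is charged to the \<open>p\<close>-th moment of \<open>G\<close>.\<close>

lemma mixture_tail_moment:
  assumes G: "G \<in> prob_nonneg" and m: "moment p G \<le> ennreal M" and M: "0 \<le> M"
    and q: "0 < q" "q \<le> p" "q \<le> 1" and K: "1 \<le> K"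
  defines "\<tau> \<equiv> \<lambda>y. if K < real y then real y powr q * mixture G y else 0"
  shows "summable \<tau>"
    "(\<Sum>y. \<tau> y) \<le> K powr q * (8 / K) powr p * M + exp (- K / 2) * (\<Sum>y. real y * exp (- real y / 2))"
proof -
  define a where "a = (\<lambda>y. \<integral>\<theta>. \<theta> powr p * Poi y \<theta> \<partial>G)"
  have a: "integrable G (\<lambda>\<theta>. \<theta> powr p * Poi y \<theta>)" "0 \<le> a y" "summable a" "(\<Sum>y. a y) \<le> M" for y
    unfolding a_def by (rule size_biased_mixture_sum[OF G m M])+
  define C where "C = K powr q * (8 / K) powr p"
  define b where "b = (\<lambda>y. C * a y + exp (- K / 2) * (real y * exp (- real y / 2)))"
  interpret prob_space G by (rule prob_space_prob_nonneg) fact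
  have pt: "real y powr q * Poi y \<theta> \<le> C * (\<theta> powr p * Poi y \<theta>) + exp (- K / 2) * (real y * exp (- real y / 2))"
    if y: "K < real y" and \<theta>: "0 \<le> \<theta>" for y \<theta>
  proof (cases "8 * \<theta> \<le> real y")
    case True
    have "real y powr q \<le> real y powr 1" using y K q by (intro powr_mono) auto
    then have "real y powr q * Poi y \<theta> \<le> real y * exp (- real y)"
      using y K Poi_small_rate[OF True \<theta>] by (intro mult_mono) (auto simp: Poi_nonneg \<theta>)
    also have "exp (- real y) = exp (- real y / 2) * exp (- real y / 2)" by (simp add: exp_add[symmetric])
    also have "real y * (exp (- real y / 2) * exp (- real y / 2)) \<le> real y * (exp (- real y / 2) * exp (- K / 2))"
      using y by (intro mult_left_mono) auto
    finally have "real y powr q * Poi y \<theta> \<le> exp (- K / 2) * (real y * exp (- real y / 2))" by (simp add: mult_ac)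
    moreover have "0 \<le> C * (\<theta> powr p * Poi y \<theta>)" using Poi_nonneg[OF \<theta>] by (simp add: C_def)
    ultimately show ?thesis by simp
  next
    case False
    \<comment> \<open>As \<open>K < y\<close>, raising \<open>y / K\<close> to the power
      \<open>p\<close> instead of \<open>q\<close> only enlarges it; this retains the full decay
      \<open>(8 / K) powr p\<close> at the price of \<open>K powr q\<close>.\<close>
    have "real y powr q = K powr q * (real y / K) powr q" using K y by (simp add: powr_divide)
    also have "\<dots> \<le> K powr q * (real y / K) powr p"
      using K y q by (intro mult_left_mono powr_mono) auto
    also have "\<dots> \<le> K powr q * (8 / K * \<theta>) powr p"
      using K y q False by (intro mult_left_mono powr_mono2) (auto simp: field_simps)
    also have "\<dots> = C * \<theta> powr p" using K \<theta> unfolding C_def by (subst powr_mult) auto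
    finally have "real y powr q * Poi y \<theta> \<le> C * \<theta> powr p * Poi y \<theta>"
      using Poi_nonneg[OF \<theta>] by (intro mult_right_mono) auto
    moreover have "0 \<le> exp (- K / 2) * (real y * exp (- real y / 2))" by simp
    ultimately show ?thesis by (simp only: mult.assoc)
  qed
  have le: "\<tau> y \<le> b y" for y
  proof (cases "K < real y")
    case True
    have "\<tau> y = (\<integral>\<theta>. real y powr q * Poi y \<theta> \<partial>G)"
      using True by (simp add: \<tau>_def mixture_def)
    also have "\<dots> \<le> (\<integral>\<theta>. C * (\<theta> powr p * Poi y \<theta>) + exp (- K / 2) * (real y * exp (- real y / 2)) \<partial>G)"
      by (intro integral_mono integrable_mult_right integrable_Poi[OF G] Bochner_Integration.integrable_add a(1))
        (use pt[OF True] in \<open>auto simp: space_prob_nonneg[OF G]\<close>)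
    also have "\<dots> = (\<integral>\<theta>. C * (\<theta> powr p * Poi y \<theta>) \<partial>G) + (\<integral>\<theta>. exp (- K / 2) * (real y * exp (- real y / 2)) \<partial>G)"
      by (rule Bochner_Integration.integral_add) (use a(1) in auto)
    also have "\<dots> = b y" by (simp add: b_def a_def prob_space)
    finally show ?thesis .
  next
    case False
    then show ?thesis using a(2)[of y] by (simp add: \<tau>_def b_def C_def)
  qed
  have b: "b sums (C * (\<Sum>y. a y) + exp (- K / 2) * (\<Sum>y. real y * exp (- real y / 2)))"
    unfolding b_def by (intro sums_add sums_mult summable_sums a(3) summable_n_exp)
  have nn: "0 \<le> \<tau> y" for y using mixture_nonneg[OF G] by (simp add: \<tau>_def)
  show s: "summable \<tau>"
    by (rule summable_comparison_test'[of b 0]) (use b le nn in \<open>auto simp: sums_iff\<close>)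
  have "(\<Sum>y. \<tau> y) \<le> (\<Sum>y. b y)" by (rule suminf_le) (use le s b in \<open>auto simp: sums_iff\<close>)
  also have "\<dots> = C * (\<Sum>y. a y) + exp (- K / 2) * (\<Sum>y. real y * exp (- real y / 2))"
    using b by (simp add: sums_iff)
  also have "C * (\<Sum>y. a y) \<le> C * M" by (intro mult_left_mono a(4)) (auto simp: C_def)
  finally show "(\<Sum>y. \<tau> y) \<le> K powr q * (8 / K) powr p * M
      + exp (- K / 2) * (\<Sum>y. real y * exp (- real y / 2))"
    by (simp add: C_def)
qed

text \<open>Split at \<open>z\<close>, the inverse square of \<open>N * Y\<close>. Above it, the
  extra power costs at most \<open>(N * Y) powr (1 / ln N)\<close>, and
  \<open>N powr (1 / ln N) = exp 1\<close>. Below it, the exponent is still at least 3/4 because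
  \<open>2 \<le> ln N\<close>, so what remains is summable over integers \<open>Y\<close> and its
  sum is small against \<open>1 / N\<close>.\<close>

lemma powr_tail_split:
  fixes x N Y :: real
  assumes x: "0 \<le> x" "x \<le> 1" and N: "3 \<le> N" and L: "2 \<le> ln N" and Y: "1 \<le> Y"
  shows "x powr (1 - 1 / (2 * ln N)) \<le> exp 1 * (Y powr (1 / ln N) * x) + N powr (-3/2) * Y powr (-3/2)"
proof -
  define r where "r = 1 / (2 * ln N)"
  have r: "0 < r" "r \<le> 1/4" using L by (auto simp: r_def field_simps)
  define z where "z = (N * Y) powr (-2)"
  have z: "0 < z" "z \<le> 1" using N Y by (auto simp: z_def powr_minus_divide field_simps mult_ge1_I)
  consider "x = 0" | "z \<le> x" | "0 < x" "x < z" using x by linarith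
  then show ?thesis
  proof cases
    case 1 then show ?thesis by simp
  next
    case 2
    have "x powr (1 - r) = x * x powr (-r)" using 2 z by (simp add: powr_diff powr_minus_divide)
    also have "\<dots> \<le> x * z powr (-r)" using 2 z r x by (intro mult_left_mono powr_mono2') auto
    also have "z powr (-r) = N powr (1 / ln N) * Y powr (1 / ln N)"
      using N Y by (simp add: z_def powr_powr r_def powr_mult)
    also have "N powr (1 / ln N) = exp 1" using L N by (simp add: powr_def)
    finally have "x powr (1 - r) \<le> exp 1 * (Y powr (1 / ln N) * x)" using x by (simp add: mult_ac)
    moreover have "0 \<le> N powr (-3/2) * Y powr (-3/2)" by simp
    ultimately show ?thesis unfolding r_def by linarith
  next
    case 3
    have "x powr (1 - r) \<le> z powr (1 - r)" using 3 r by (intro powr_mono2) auto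
    also have "\<dots> \<le> z powr (3/4)" using z r by (intro powr_mono') auto
    also have "\<dots> = N powr (-3/2) * Y powr (-3/2)"
      using N Y by (simp add: z_def powr_powr powr_mult)
    moreover have "0 \<le> exp 1 * (Y powr (1 / ln N) * x)" using x by simp
    ultimately show ?thesis unfolding r_def by linarith
  qed
qed

text \<open>The \<open>exp 15\<close> combines \<open>exp 1\<close> from splitting the power with
  \<open>exp 14\<close>, the bound for \<open>K powr (1 / ln N)\<close>. The other two terms collect
  the observations far above their rates and the values where the mixture is tiny.\<close>

definition tail_const :: "real \<Rightarrow> real" where
  "tail_const p = exp 15 * 8 powr p + exp 1 * (\<Sum>y. real y * exp (- real y / 2))
     + (\<Sum>y. real y powr (-3/2))"

lemma summable_powr_3_2: "summable (\<lambda>y. real y powr (-3/2))"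
  by (subst summable_real_powr_iff) simp

lemma tail_const_nonneg: "0 \<le> tail_const p"
  unfolding tail_const_def
  by (intro add_nonneg_nonneg mult_nonneg_nonneg suminf_nonneg summable_n_exp summable_powr_3_2) auto

text \<open>A crude polynomial bound is enough, since the cutoff enters only through its logarithm
  or its power \<open>1 / ln N\<close>. The exponent is 10 + 1 + 3, the last because
  \<open>27 \<le> N ^ 3\<close>.\<close>

lemma cutoff_le:
  fixes \<kappa> N :: real
  assumes N: "3 \<le> N" and \<kappa>: "1 \<le> \<kappa>" "\<kappa> \<le> N ^ 5"
  shows "20 * \<kappa>\<^sup>2 * ln N + 1 \<le> N ^ 14"
proof -
  have "\<kappa>\<^sup>2 \<le> N ^ 10" using power_mono[OF \<kappa>(2), of 2] \<kappa> by (simp add: power_mult[symmetric])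
  moreover have "0 \<le> ln N" using N by simp
  moreover have "ln N \<le> N" using N ln_le_minus_one[of N] by linarith
  ultimately have "20 * \<kappa>\<^sup>2 * ln N \<le> 20 * N ^ 10 * N" by (intro mult_mono) auto
  also have "\<dots> + 1 \<le> 27 * N ^ 11"
  proof -
    have "N ^ 10 * N = N ^ 11" by (simp add: power_Suc2[symmetric] del: power_Suc2)
    moreover have "1 \<le> N ^ 11" using N by (intro one_le_power) simp
    ultimately show ?thesis by simp
  qed
  also have "\<dots> \<le> N ^ 3 * N ^ 11"
    using power_mono[of 3 N 3] N by (intro mult_right_mono) auto
  also have "\<dots> = N ^ 14" by (simp add: power_add[symmetric])
  finally show ?thesis by simp
qed

text \<open>Here the choice of \<open>\<kappa>\<close> pays off: \<open>K\<close> is at least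
  \<open>\<kappa>\<^sup>2\<close>, so \<open>N * M * K powr (- p)\<close> is at most
  \<open>\<kappa> powr (2 * p + 1) * \<kappa> powr (- 2 * p)\<close>, which is
  \<open>\<kappa>\<close>. The factor \<open>ln N\<close> in \<open>K\<close> makes the exponential
  part at most of order \<open>1 / N\<close>, and \<open>1 / p \<le> ln N\<close> keeps the extra
  power below \<open>p\<close>.\<close>

lemma mixture_tail_bound:
  fixes N M p \<kappa> :: real
  assumes p: "0 < p" and G: "G \<in> prob_nonneg" and m: "moment p G \<le> ennreal M" and M: "0 \<le> M"
    and N: "3 \<le> N" and L: "2 \<le> ln N" "1 / p \<le> ln N"
    and \<kappa>: "1 \<le> \<kappa>" "\<kappa> \<le> N ^ 5" "N * M \<le> \<kappa> powr (2 * p + 1)"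
  defines "K \<equiv> 20 * \<kappa>\<^sup>2 * ln N"
  defines "\<tau> \<equiv> \<lambda>y. if K < real y then mixture G y powr (1 - 1 / (2 * ln N)) else 0"
  shows "summable \<tau>" "N * (\<Sum>y. \<tau> y) \<le> tail_const p * \<kappa>"
proof -
  define q where "q = 1 / ln N"
  define W where "W = (\<Sum>y. real y * exp (- real y / 2))"
  define Z where "Z = (\<Sum>y. real y powr (-3/2))"
  have W: "0 \<le> W" unfolding W_def by (intro suminf_nonneg summable_n_exp) auto
  have Z: "0 \<le> Z" unfolding Z_def by (intro suminf_nonneg summable_powr_3_2) auto
  have q: "0 < q" "q \<le> p" "q \<le> 1" using L p by (auto simp: q_def field_simps)
  have k1: "1 \<le> \<kappa>\<^sup>2" using \<kappa> by (simp add: one_le_power)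
  have K20: "20 * ln N \<le> K" using k1 L unfolding K_def by (simp add: mult_right_mono)
  have K1: "1 \<le> K" using K20 L by linarith
  have Kk: "\<kappa>\<^sup>2 \<le> K"
  proof -
    have "\<kappa>\<^sup>2 * 1 \<le> \<kappa>\<^sup>2 * (20 * ln N)" using L by (intro mult_left_mono) auto
    then show ?thesis by (simp add: K_def mult_ac)
  qed
  define \<sigma> where "\<sigma> = (\<lambda>y. if K < real y then real y powr q * mixture G y else 0)"
  note tm = mixture_tail_moment[OF G m M q K1, folded \<sigma>_def W_def]
  define b where "b = (\<lambda>y. exp 1 * \<sigma> y + N powr (-3/2) * real y powr (-3/2))"
  have le: "\<tau> y \<le> b y" for y
  proof (cases "K < real y")
    case True
    then show ?thesis
      using powr_tail_split[OF mixture_nonneg[OF G] mixture_le_1[OF G] N L(1), of "real y" y] K1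
      by (simp add: \<tau>_def b_def \<sigma>_def q_def)
  qed (simp add: \<tau>_def b_def \<sigma>_def)
  have nn: "0 \<le> \<tau> y" for y by (simp add: \<tau>_def)
  have b: "b sums (exp 1 * (\<Sum>y. \<sigma> y) + N powr (-3/2) * Z)"
    unfolding b_def Z_def by (intro sums_add sums_mult summable_sums tm(1) summable_powr_3_2)
  show s: "summable \<tau>"
    by (rule summable_comparison_test'[of b 0]) (use b le nn in \<open>auto simp: sums_iff\<close>)
  have tc: "tail_const p = exp 15 * 8 powr p + exp 1 * W + Z"
    by (simp only: tail_const_def W_def Z_def)
  have "K \<le> N ^ 14" using cutoff_le[OF N \<kappa>(1,2)] by (simp add: K_def)
  then have "K powr q \<le> (N ^ 14) powr q" using K1 q by (intro powr_mono2) auto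
  also have "\<dots> = exp 14" using N L by (simp add: powr_def q_def ln_realpow)
  finally have f1: "K powr q \<le> exp 14" .
  have "N * M * (8 / K) powr p = 8 powr p * (N * M * K powr (-p))"
    using K1 by (simp add: powr_divide powr_minus_divide)
  also have "\<dots> \<le> 8 powr p * (\<kappa> powr (2 * p + 1) * (\<kappa>\<^sup>2) powr (-p))"
    using \<kappa> Kk k1 p M N by (intro mult_left_mono mult_mono powr_mono2') auto
  also have "(\<kappa>\<^sup>2) powr (-p) = \<kappa> powr (-2 * p)"
    using \<kappa> by (simp add: powr_powr flip: powr_numeral)
  also have "\<kappa> powr (2 * p + 1) * \<kappa> powr (-2 * p) = \<kappa>"
    using \<kappa> by (simp add: powr_add[symmetric])
  finally have f2: "N * M * (8 / K) powr p \<le> 8 powr p * \<kappa>" .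
  have "exp (- K / 2) \<le> exp (- ln N)" using K20 L by simp
  then have f3: "N * exp (- K / 2) \<le> 1" using N by (simp add: exp_minus field_simps)
  have "N * N powr (-3/2) = N powr 1 * N powr (-3/2)" using N by simp
  also have "\<dots> = N powr (-1/2)" by (simp only: powr_add[symmetric]) simp
  also have "\<dots> \<le> N powr 0" using N by (intro powr_mono) auto
  finally have f4: "N * N powr (-3/2) \<le> 1" using N by simp
  have "(\<Sum>y. \<tau> y) \<le> (\<Sum>y. b y)" by (rule suminf_le) (use le s b in \<open>auto simp: sums_iff\<close>)
  also have "\<dots> = exp 1 * (\<Sum>y. \<sigma> y) + N powr (-3/2) * Z" using b by (simp add: sums_iff)
  also have "exp 1 * (\<Sum>y. \<sigma> y) \<le> exp 1 * (K powr q * (8 / K) powr p * M + exp (- K / 2) * W)"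
    using tm(2) by simp
  finally have "N * (\<Sum>y. \<tau> y)
      \<le> N * (exp 1 * (K powr q * (8 / K) powr p * M + exp (- K / 2) * W) + N powr (-3/2) * Z)"
    using N by simp
  also have "\<dots> = exp 1 * K powr q * (N * M * (8 / K) powr p) + exp 1 * (N * exp (- K / 2)) * W
      + N * N powr (-3/2) * Z"
    by (simp add: algebra_simps)
  also have "\<dots> \<le> exp 1 * exp 14 * (8 powr p * \<kappa>) + exp 1 * 1 * W + 1 * Z"
    by (intro add_mono mult_mono[OF mult_left_mono[OF f1] f2] mult_right_mono[OF mult_left_mono[OF f3]]
        mult_right_mono[OF f4]) (use W Z M N in auto)
  also have "\<dots> \<le> exp 15 * (8 powr p * \<kappa>) + exp 1 * W * \<kappa> + Z * \<kappa>"
    using mult_left_mono[OF \<kappa>(1), of "exp 1 * W"] mult_left_mono[OF \<kappa>(1), of Z] W Z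
    by (intro add_mono) (simp_all add: exp_add[symmetric])
  also have "\<dots> = tail_const p * \<kappa>"
    by (simp only: tc distrib_right mult.assoc)
  finally show "N * (\<Sum>y. \<tau> y) \<le> tail_const p * \<kappa>" .
qed

section \<open>Deviation of the maximum likelihood estimator\<close>

lemma real_sqrt_prod:
  fixes f :: "'a \<Rightarrow> real"
  shows "sqrt (\<Prod>i\<in>A. f i) = (\<Prod>i\<in>A. sqrt (f i))"
  by (induction A rule: infinite_finite_induct) (auto simp: real_sqrt_mult)

lemma one_plus_power_le_exp:
  fixes x :: real
  assumes "0 \<le> 1 + x"
  shows "(1 + x) ^ n \<le> exp (real n * x)"
proof -
  have "(1 + x) ^ n \<le> exp x ^ n" using assms by (intro power_mono) auto
  then show ?thesis by (simp add: exp_of_nat_mult)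
qed

lemma sums_cutoff_const:
  fixes K \<eta> :: real
  assumes "0 \<le> K" "0 \<le> \<eta>"
  shows "summable (\<lambda>y. if real y \<le> K then \<eta> else 0)"
    and "(\<Sum>y. if real y \<le> K then \<eta> else 0) \<le> \<eta> * (K + 1)"
proof -
  define m where "m = nat \<lfloor>K\<rfloor>"
  have m: "real y \<le> K \<longleftrightarrow> y \<in> {..m}" for y unfolding m_def using assms by (auto simp: le_nat_iff le_floor_iff)
  have mK: "real m \<le> K" unfolding m_def using assms by simp
  have "(\<lambda>y. if y \<in> {..m} then \<eta> else 0) sums (\<Sum>y\<in>{..m}. \<eta>)" by (rule sums_If_finite_set) simp
  then have s: "(\<lambda>y. if real y \<le> K then \<eta> else 0) sums ((real m + 1) * \<eta>)" by (simp add: m algebra_simps)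
  then show "summable (\<lambda>y. if real y \<le> K then \<eta> else 0)" by (rule sums_summable)
  have "(real m + 1) * \<eta> \<le> \<eta> * (K + 1)" using assms mK
    by (simp only: mult.commute[of \<eta>]) (intro mult_right_mono, auto)
  then show "(\<Sum>y. if real y \<le> K then \<eta> else 0) \<le> \<eta> * (K + 1)" using s by (simp add: sums_iff)
qed

text \<open>\<open>g\<close> lies above every mixture in the cell of \<open>Q\<close> on the values
  up to \<open>K\<close> and equals the truth beyond. Its affinity with the truth is at most
  \<open>1 - h\<^sup>2 / 2\<close> plus \<open>1 / n\<close> for the inflation \<open>\<eta>\<close>
  and the tail sum. The \<open>n\<close>-th power gives the exponent
  \<open>- n * h\<^sup>2 / 2\<close>, half of which is spent on \<open>exp (s / 2)\<close>.\<close>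

lemma measure_likelihood_ratio_le:
  fixes K h S r :: real
  assumes G: "G \<in> prob_nonneg" and Q: "Q \<in> prob_nonneg" and n: "1 \<le> n" and K: "0 \<le> K"
    and h: "0 \<le> h" "h \<le> hellinger (mixture Q) (mixture G)"
    and r: "0 \<le> r" "r \<le> 1"
  defines "\<eta> \<equiv> 1 / (real n ^ 2 * (K + 1))"
  defines "\<tau> \<equiv> \<lambda>y. if K < real y then mixture G y powr (1 - r) else 0"
  assumes \<tau>: "summable \<tau>"
  defines "s \<equiv> real n * h\<^sup>2 / 2"
  defines "g \<equiv> \<lambda>y. if real y \<le> K then mixture Q y + \<eta> else mixture G y"
  shows "measure (sample_law n G) {Y \<in> space (sample_law n G).
      exp (- s) * (\<Prod>i\<in>{1..n}. mixture G (Y i)) \<le> (\<Prod>i\<in>{1..n}. g (Y i))}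
    \<le> exp (- (real n * h\<^sup>2 / 4) + 1 + real n * (\<Sum>y. \<tau> y))"
proof -
  let ?f = "mixture G" and ?q = "mixture Q"
  note f0 = mixture_nonneg[OF G] and q0 = mixture_nonneg[OF Q]
  have \<eta>: "0 \<le> \<eta>" using K by (simp add: \<eta>_def)
  have g0: "0 \<le> g y" for y using f0 q0 \<eta> by (simp add: g_def)
  note H = hellinger_sq_pmf[OF mixture_sums[OF Q] q0 mixture_sums[OF G] f0]
  define k where "k = (\<lambda>y. sqrt (g y * ?f y))"
  define c where "c = (\<lambda>y::nat. if real y \<le> K then real n * \<eta> else 0)"
  define b where "b = (\<lambda>y. sqrt (?q y * ?f y) + (c y + ?f y / real n) / 2 + \<tau> y)"
  have kb: "k y \<le> b y" for y
  proof (cases "real y \<le> K")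
    case True
    have "k y = sqrt (?q y * ?f y + \<eta> * ?f y)" using True by (simp add: k_def g_def algebra_simps)
    also have "\<dots> \<le> sqrt (?q y * ?f y) + sqrt (\<eta> * ?f y)"
      by (rule sqrt_add_le_add_sqrt) (use f0 q0 \<eta> in auto)
    \<comment> \<open>The weight \<open>n\<close> balances the two means: \<open>n * \<eta>\<close>
      summed over at most \<open>K + 1\<close> values, and \<open>f / n\<close> summed over all
      values, each give at most \<open>1 / n\<close>.\<close>
    also have "sqrt (\<eta> * ?f y) = sqrt (real n * \<eta> * (?f y / real n))" using n by simp
    also have "\<dots> \<le> (real n * \<eta> + ?f y / real n) / 2"
      by (rule arith_geo_mean_sqrt) (use \<eta> f0 in auto)
    finally show ?thesis using True by (simp add: b_def c_def \<tau>_def)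
  next
    case False
    have "k y = ?f y powr 1" using False f0[of y] by (simp add: k_def g_def)
    also have "\<dots> \<le> ?f y powr (1 - r)"
      using r f0[of y] mixture_le_1[OF G, of y] by (intro powr_mono') auto
    also have "\<dots> = \<tau> y" using False by (simp add: \<tau>_def)
    also have "\<dots> \<le> b y" using f0[of y] q0[of y] False by (simp add: b_def c_def)
    finally show ?thesis .
  qed
  have k0: "0 \<le> k y" for y using f0 g0 by (simp add: k_def)
  have c: "summable c" "(\<Sum>y. c y) \<le> real n * \<eta> * (K + 1)"
    unfolding c_def using sums_cutoff_const[of K "real n * \<eta>"] K \<eta> by auto
  have b: "b sums ((\<Sum>y. sqrt (?q y * ?f y)) + ((\<Sum>y. c y) + 1 / real n) / 2 + (\<Sum>y. \<tau> y))"
    unfolding b_def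
    by (intro sums_add sums_divide summable_sums H(1) c(1) \<tau> mixture_sums[OF G])
  have ks: "summable k"
    by (rule summable_comparison_test'[of b 0]) (use b kb k0 in \<open>auto simp: sums_iff\<close>)
  have c_le: "(\<Sum>y. c y) \<le> 1 / real n"
  proof -
    have "real n * \<eta> * (K + 1) = 1 / real n"
      using n K by (simp add: \<eta>_def power2_eq_square add_nonneg_eq_0_iff)
    then show ?thesis using c(2) by simp
  qed
  have h_le: "h\<^sup>2 \<le> hellinger_sq ?q ?f"
  proof -
    have "h\<^sup>2 \<le> (sqrt (hellinger_sq ?q ?f))\<^sup>2"
      by (rule power_mono) (use h in \<open>auto simp: hellinger_def\<close>)
    then show ?thesis by (simp only: real_sqrt_pow2[OF H(3)])
  qed
  have "suminf k \<le> suminf b" by (rule suminf_le) (use kb ks b in \<open>auto simp: sums_iff\<close>)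
  moreover have "suminf b = (\<Sum>y. sqrt (?q y * ?f y)) + (suminf c + 1 / real n) / 2 + suminf \<tau>"
    using sums_unique[OF b] by simp
  moreover have "(suminf c + 1 / real n) / 2 \<le> 1 / real n" using c_le by simp
  moreover have "(\<Sum>y. sqrt (?q y * ?f y)) \<le> 1 - h\<^sup>2 / 2" using H(2) h_le by simp
  ultimately have "suminf k \<le> 1 + (1 / real n + suminf \<tau> - h\<^sup>2 / 2)" by linarith
  then have k_le: "(\<Sum>y. k y) \<le> 1 + (1 / real n + (\<Sum>y. \<tau> y) - h\<^sup>2 / 2)" .
  have k_nn: "0 \<le> (\<Sum>y. k y)" by (rule suminf_nonneg[OF ks k0])
  have "(\<Sum>y. k y) ^ n \<le> (1 + (1 / real n + (\<Sum>y. \<tau> y) - h\<^sup>2 / 2)) ^ n"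
    by (rule power_mono[OF k_le k_nn])
  also have "\<dots> \<le> exp (real n * (1 / real n + (\<Sum>y. \<tau> y) - h\<^sup>2 / 2))"
    by (rule one_plus_power_le_exp) (use k_le k_nn in linarith)
  also have "\<dots> = exp (1 + real n * (\<Sum>y. \<tau> y) - real n * h\<^sup>2 / 2)"
    using n by (simp add: algebra_simps)
  finally have pw: "(\<Sum>y. k y) ^ n \<le> exp (1 + real n * (\<Sum>y. \<tau> y) - real n * h\<^sup>2 / 2)" .
  have "measure (sample_law n G) {Y \<in> space (sample_law n G).
      exp (- s) * (\<Prod>i\<in>{1..n}. ?f (Y i)) \<le> (\<Prod>i\<in>{1..n}. g (Y i))} \<le> exp (s / 2) * (\<Sum>y. k y) ^ n"
  proof (rule measure_sample_law_le[OF G ks k0])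
    fix Y assume Y: "Y \<in> {Y \<in> space (sample_law n G).
      exp (- s) * (\<Prod>i\<in>{1..n}. ?f (Y i)) \<le> (\<Prod>i\<in>{1..n}. g (Y i))}"
    define F where "F = (\<Prod>i\<in>{1..n}. ?f (Y i))"
    have F0: "0 \<le> F" unfolding F_def by (intro prod_nonneg) (use f0 in auto)
    have le: "F \<le> exp s * (\<Prod>i\<in>{1..n}. g (Y i))"
      using Y by (simp add: F_def exp_minus field_simps)
    have "F = sqrt (F * F)" using F0 by simp
    also have "\<dots> \<le> sqrt (exp s * (\<Prod>i\<in>{1..n}. g (Y i)) * F)"
      by (intro real_sqrt_le_mono mult_right_mono le F0)
    also have "\<dots> = sqrt (exp s) * (\<Prod>i\<in>{1..n}. k (Y i))"
      by (simp add: real_sqrt_mult F_def k_def prod.distrib real_sqrt_prod)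
    also have "sqrt (exp s) = exp (s / 2)"
      by (rule real_sqrt_unique) (simp_all add: exp_of_nat_mult[symmetric])
    finally show "(\<Prod>i\<in>{1..n}. ?f (Y i)) \<le> exp (s / 2) * (\<Prod>i\<in>{1..n}. k (Y i))" by (simp add: F_def)
  qed auto
  also have "\<dots> \<le> exp (s / 2) * exp (1 + real n * (\<Sum>y. \<tau> y) - real n * h\<^sup>2 / 2)"
    by (intro mult_left_mono pw) auto
  also have "\<dots> = exp (- (real n * h\<^sup>2 / 4) + 1 + real n * (\<Sum>y. \<tau> y))"
    by (simp add: exp_add[symmetric] s_def)
  finally show ?thesis .
qed

text \<open>Markov's inequality for the power \<open>- r\<close> of the tail likelihood. Raising
  only the factors above \<open>K\<close> to the power \<open>1 - r\<close> increases the total mass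
  from 1 to at most 1 plus the tail sum.\<close>

lemma measure_tail_likelihood_le:
  fixes K s r :: real
  assumes G: "G \<in> prob_nonneg" and r: "0 \<le> r" "r \<le> 1"
  defines "\<tau> \<equiv> \<lambda>y. if K < real y then mixture G y powr (1 - r) else 0"
  assumes \<tau>: "summable \<tau>"
  shows "measure (sample_law n G) {Y \<in> space (sample_law n G).
      (\<Prod>i\<in>{1..n}. if K < real (Y i) then mixture G (Y i) else 1) \<le> exp (- s)}
    \<le> exp (- (r * s) + real n * (\<Sum>y. \<tau> y))"
proof -
  let ?f = "mixture G"
  note f0 = mixture_nonneg[OF G]
  define k where "k = (\<lambda>y. if K < real y then ?f y powr (1 - r) else ?f y)"
  have kb: "k y \<le> ?f y + \<tau> y" for y using f0[of y] by (simp add: k_def \<tau>_def)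
  have k0: "0 \<le> k y" for y using f0[of y] by (simp add: k_def)
  have b: "(\<lambda>y. ?f y + \<tau> y) sums (1 + (\<Sum>y. \<tau> y))"
    by (intro sums_add summable_sums \<tau> mixture_sums[OF G])
  have ks: "summable k"
    by (rule summable_comparison_test'[of "\<lambda>y. ?f y + \<tau> y" 0]) (use b kb k0 in \<open>auto simp: sums_iff\<close>)
  have k_le: "(\<Sum>y. k y) \<le> 1 + (\<Sum>y. \<tau> y)"
    using suminf_le[OF kb ks] b by (auto simp: sums_iff)
  have k_nn: "0 \<le> (\<Sum>y. k y)" by (rule suminf_nonneg[OF ks k0])
  have "(\<Sum>y. k y) ^ n \<le> (1 + (\<Sum>y. \<tau> y)) ^ n"
    by (rule power_mono[OF k_le k_nn])
  also have "\<dots> \<le> exp (real n * (\<Sum>y. \<tau> y))"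
    by (rule one_plus_power_le_exp) (use k_le k_nn in linarith)
  finally have pw: "(\<Sum>y. k y) ^ n \<le> exp (real n * (\<Sum>y. \<tau> y))" .
  have "measure (sample_law n G) {Y \<in> space (sample_law n G).
      (\<Prod>i\<in>{1..n}. if K < real (Y i) then ?f (Y i) else 1) \<le> exp (- s)}
    \<le> exp (- (r * s)) * (\<Sum>y. k y) ^ n"
  proof (rule measure_sample_law_le[OF G ks k0])
    fix Y assume Y: "Y \<in> {Y \<in> space (sample_law n G).
      (\<Prod>i\<in>{1..n}. if K < real (Y i) then ?f (Y i) else 1) \<le> exp (- s)}"
    define P where "P = (\<Prod>i\<in>{1..n}. if K < real (Y i) then ?f (Y i) else 1)"
    define P' where "P' = (\<Prod>i\<in>{1..n}. if K < real (Y i) then 1 else ?f (Y i))"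
    have P0: "0 \<le> P" "0 \<le> P'" unfolding P_def P'_def by (intro prod_nonneg; use f0 in auto)+
    have P: "P \<le> exp (- s)" using Y by (simp add: P_def)
    have F: "(\<Prod>i\<in>{1..n}. ?f (Y i)) = P' * P"
      unfolding P_def P'_def prod.distrib[symmetric] by (intro prod.cong) auto
    have "P = P powr (1 - r) * P powr r"
      using P0 by (cases "P = 0") (auto simp: powr_add[symmetric])
    also have "\<dots> \<le> P powr (1 - r) * exp (- s) powr r"
      using P P0 r by (intro mult_left_mono powr_mono2) auto
    also have "exp (- s) powr r = exp (- (r * s))" by (simp add: powr_def)
    finally have "P' * P \<le> P' * (P powr (1 - r) * exp (- (r * s)))"
      by (rule mult_left_mono[OF _ P0(2)])
    also have "P powr (1 - r) = (\<Prod>i\<in>{1..n}. if K < real (Y i) then ?f (Y i) powr (1 - r) else 1)"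
      unfolding P_def
      by (subst prod_powr_distrib) (use f0 in \<open>auto intro!: prod.cong\<close>)
    also have "P' * (\<dots> * exp (- (r * s))) = exp (- (r * s)) * (\<Prod>i\<in>{1..n}. k (Y i))"
    proof -
      have "P' * (\<Prod>i\<in>{1..n}. if K < real (Y i) then ?f (Y i) powr (1 - r) else 1) = (\<Prod>i\<in>{1..n}. k (Y i))"
        unfolding P'_def prod.distrib[symmetric] by (intro prod.cong) (auto simp: k_def)
      then show ?thesis by (simp add: mult_ac)
    qed
    finally show "(\<Prod>i\<in>{1..n}. ?f (Y i)) \<le> exp (- (r * s)) * (\<Prod>i\<in>{1..n}. k (Y i))"
      unfolding F .
  qed auto
  also have "\<dots> \<le> exp (- (r * s)) * exp (real n * (\<Sum>y. \<tau> y))"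
    by (intro mult_left_mono pw) auto
  also have "\<dots> = exp (- (r * s) + real n * (\<Sum>y. \<tau> y))" by (rule exp_add[symmetric])
  finally show ?thesis .
qed

lemma npmle_likelihood:
  assumes "is_npmle n Y Q" "G \<in> prob_nonneg"
  shows "Q \<in> prob_nonneg" "(\<Prod>i\<in>{1..n}. mixture G (Y i)) \<le> (\<Prod>i\<in>{1..n}. mixture Q (Y i))"
  using assms by (auto simp: is_npmle_def is_arg_max_linorder)

text \<open>A union bound over the cells that meet the far set, with a single extra event for the
  observations above \<open>K\<close>, common to all cells.\<close>

lemma npmle_deviation_by_cover:
  fixes K h r N :: real and \<Phi> :: "real measure \<Rightarrow> 'c"
  assumes G: "G \<in> prob_nonneg" and n: "1 \<le> n" and K: "0 \<le> K" and h: "0 \<le> h" and r: "0 \<le> r" "r \<le> 1"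
    and np: "\<And>Y. is_npmle n Y (Ghat Y)"
    and fin: "finite (\<Phi> ` prob_nonneg)" and card: "real (card (\<Phi> ` prob_nonneg)) \<le> N"
    and cl: "\<And>Q Q' y. Q \<in> prob_nonneg \<Longrightarrow> Q' \<in> prob_nonneg \<Longrightarrow> \<Phi> Q = \<Phi> Q' \<Longrightarrow> real y \<le> K \<Longrightarrow>
       mixture Q y \<le> mixture Q' y + 1 / (real n ^ 2 * (K + 1))"
  defines "\<tau> \<equiv> \<lambda>y. if K < real y then mixture G y powr (1 - r) else 0"
  assumes \<tau>: "summable \<tau>"
  shows "\<P>(Y in sample_law n G. h \<le> hellinger (mixture (Ghat Y)) (mixture G))
    \<le> N * exp (- (real n * h\<^sup>2 / 4) + 1 + real n * (\<Sum>y. \<tau> y))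
      + exp (- (r * (real n * h\<^sup>2 / 2)) + real n * (\<Sum>y. \<tau> y))"
proof -
  interpret prob_space "sample_law n G" by (rule prob_space_sample_law[OF G])
  let ?f = "mixture G"
  define \<eta> where "\<eta> = 1 / (real n ^ 2 * (K + 1))"
  define s where "s = real n * h\<^sup>2 / 2"
  note f0 = mixture_nonneg[OF G]
  have \<eta>: "0 \<le> \<eta>" using K by (simp add: \<eta>_def)
  define far where "far = {Q \<in> prob_nonneg. h \<le> hellinger (mixture Q) ?f}"
  define J where "J = \<Phi> ` far"
  \<comment> \<open>Representatives are themselves far from the truth, so the bound \<open>h\<close>
    applies to them with no triangle inequality and no loss in the radius.\<close>
  define rep where "rep = (\<lambda>j. SOME Q. Q \<in> far \<and> \<Phi> Q = j)"
  have rep: "rep j \<in> far" "\<Phi> (rep j) = j" if "j \<in> J" for j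
    using someI_ex[of "\<lambda>Q. Q \<in> far \<and> \<Phi> Q = j"] that unfolding rep_def J_def by auto
  define g where "g = (\<lambda>Q y. if real y \<le> K then mixture Q y + \<eta> else ?f y)"
  define A where "A = (\<lambda>j. {Y \<in> space (sample_law n G).
      exp (- s) * (\<Prod>i\<in>{1..n}. ?f (Y i)) \<le> (\<Prod>i\<in>{1..n}. g (rep j) (Y i))})"
  define B where "B = {Y \<in> space (sample_law n G).
      (\<Prod>i\<in>{1..n}. if K < real (Y i) then ?f (Y i) else 1) \<le> exp (- s)}"
  have J: "finite J" "real (card J) \<le> N"
  proof -
    have "J \<subseteq> \<Phi> ` prob_nonneg" unfolding J_def far_def by auto
    then show "finite J" "real (card J) \<le> N"
      using fin card card_mono[of "\<Phi> ` prob_nonneg" J] by (auto intro: finite_subset)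
  qed
  have sets: "E \<in> sets (sample_law n G)" if "E \<subseteq> space (sample_law n G)" for E
    using that unfolding sample_law_eq sets_iid_law by auto
  have "{Y \<in> space (sample_law n G). h \<le> hellinger (mixture (Ghat Y)) ?f} \<subseteq> (\<Union>j\<in>J. A j) \<union> B"
  proof
    fix Y assume Y: "Y \<in> {Y \<in> space (sample_law n G). h \<le> hellinger (mixture (Ghat Y)) ?f}"
    let ?Q = "Ghat Y" let ?j = "\<Phi> ?Q"
    note lik = npmle_likelihood[OF np G]
    have far: "?Q \<in> far" using Y lik(1) by (simp add: far_def)
    then have j: "?j \<in> J" by (simp add: J_def)
    have repj: "rep ?j \<in> prob_nonneg" using rep(1)[OF j] by (simp add: far_def)
    show "Y \<in> (\<Union>j\<in>J. A j) \<union> B"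
    proof (rule ccontr)
      assume no: "Y \<notin> (\<Union>j\<in>J. A j) \<union> B"
      define P where "P = (\<Prod>i\<in>{1..n}. if K < real (Y i) then ?f (Y i) else 1)"
      have P: "exp (- s) < P" using no Y by (auto simp: B_def P_def)
      have P0: "0 \<le> P" using order.trans[OF exp_ge_zero, of "- s" P] P by simp
      have lt: "(\<Prod>i\<in>{1..n}. g (rep ?j) (Y i)) < exp (- s) * (\<Prod>i\<in>{1..n}. ?f (Y i))"
        using no j Y by (auto simp: A_def)
      \<comment> \<open>The slack \<open>exp (- s)\<close> is traded for the true likelihood
        \<open>P\<close> above \<open>K\<close>: there the product of truth and fit is at most the
        truth, because the fit is at most 1.\<close>
      have "exp (- s) * (\<Prod>i\<in>{1..n}. ?f (Y i)) \<le> P * (\<Prod>i\<in>{1..n}. mixture ?Q (Y i))"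
        using P P0 lik(2) f0 by (intro mult_mono prod_nonneg) auto
      also have "\<dots> = (\<Prod>i\<in>{1..n}. (if K < real (Y i) then ?f (Y i) else 1) * mixture ?Q (Y i))"
        by (simp add: P_def prod.distrib)
      also have "\<dots> \<le> (\<Prod>i\<in>{1..n}. g (rep ?j) (Y i))"
      proof (rule prod_mono)
        fix i assume "i \<in> {1..n}"
        have "mixture ?Q (Y i) \<le> mixture (rep ?j) (Y i) + \<eta>" if "real (Y i) \<le> K"
          unfolding \<eta>_def by (rule cl) (use lik(1) repj rep(2)[OF j] that in auto)
        moreover have "?f (Y i) * mixture ?Q (Y i) \<le> ?f (Y i)"
          using f0 mixture_le_1[OF lik(1)] by (intro mult_left_le) auto
        ultimately show "0 \<le> (if K < real (Y i) then ?f (Y i) else 1) * mixture ?Q (Y i) \<and>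
            (if K < real (Y i) then ?f (Y i) else 1) * mixture ?Q (Y i) \<le> g (rep ?j) (Y i)"
          using f0 mixture_nonneg[OF lik(1)] by (auto simp: g_def)
      qed
      finally show False using lt by simp
    qed
  qed
  then have "\<P>(Y in sample_law n G. h \<le> hellinger (mixture (Ghat Y)) ?f) \<le> prob ((\<Union>j\<in>J. A j) \<union> B)"
    by (rule finite_measure_mono) (intro sets, auto simp: A_def B_def)
  also have "\<dots> \<le> prob (\<Union>j\<in>J. A j) + prob B"
    by (rule measure_Un_le) (intro sets, auto simp: A_def B_def)+
  also have "prob (\<Union>j\<in>J. A j) \<le> (\<Sum>j\<in>J. prob (A j))"
    by (rule finite_measure_subadditive_finite[OF J(1)]) (use sets in \<open>auto simp: A_def\<close>)
  also have "\<dots> \<le> (\<Sum>j\<in>J. exp (- (real n * h\<^sup>2 / 4) + 1 + real n * (\<Sum>y. \<tau> y)))"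
  proof (rule sum_mono)
    fix j assume j: "j \<in> J"
    show "prob (A j) \<le> exp (- (real n * h\<^sup>2 / 4) + 1 + real n * (\<Sum>y. \<tau> y))"
      unfolding A_def s_def g_def \<eta>_def \<tau>_def
      by (rule measure_likelihood_ratio_le[OF G _ n K h _ r \<tau>[unfolded \<tau>_def]])
        (use rep(1)[OF j] in \<open>auto simp: far_def\<close>)
  qed
  also have "\<dots> = real (card J) * exp (- (real n * h\<^sup>2 / 4) + 1 + real n * (\<Sum>y. \<tau> y))" by simp
  also have "\<dots> \<le> N * exp (- (real n * h\<^sup>2 / 4) + 1 + real n * (\<Sum>y. \<tau> y))"
    by (intro mult_right_mono J(2)) auto
  also have "prob B \<le> exp (- (r * s) + real n * (\<Sum>y. \<tau> y))"
    unfolding B_def \<tau>_def by (rule measure_tail_likelihood_le[OF G r \<tau>[unfolded \<tau>_def]])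
  finally show ?thesis by (simp add: s_def)
qed

section \<open>Rates\<close>

text \<open>With \<open>E\<close> for \<open>n\<^sup>2 * (K + 1)\<close>, the error
  \<open>1 / E\<close> is split into \<open>1 / (4 * E)\<close> for the Taylor remainders,
  \<open>1 / (4 * E)\<close> for rates beyond the blocks and \<open>1 / (2 * E)\<close> for
  rounding. \<open>B\<close>, \<open>D\<close> and \<open>\<delta>\<close> are solved from this
  budget.\<close>

lemma mixture_cover:
  fixes \<kappa> :: real and n :: nat
  assumes n: "3 \<le> n" and L: "2 \<le> ln (real n)" and \<kappa>: "1 \<le> \<kappa>" "\<kappa> \<le> real n ^ 5"
  defines "K \<equiv> 20 * \<kappa>\<^sup>2 * ln (real n)"
  obtains \<Phi> :: "real measure \<Rightarrow> nat \<times> nat \<Rightarrow> int"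
  where "finite (\<Phi> ` prob_nonneg)"
    "real (card (\<Phi> ` prob_nonneg)) \<le> exp (20000 * \<kappa> * ln (real n) ^ 3)"
    "\<And>Q Q' y. Q \<in> prob_nonneg \<Longrightarrow> Q' \<in> prob_nonneg \<Longrightarrow> \<Phi> Q = \<Phi> Q' \<Longrightarrow> real y \<le> K \<Longrightarrow>
       mixture Q y \<le> mixture Q' y + 1 / (real n ^ 2 * (K + 1))"
proof -
  define L where "L = ln (real n)"
  define E where "E = real n ^ 2 * (K + 1)"
  define B where "B = nat \<lceil>2 * sqrt K\<rceil>"
  define D where "D = nat \<lceil>2 * ln (16 * exp 6 * E)\<rceil>"
  define \<delta> where "\<delta> = 1 / (4 * exp 6 * real B * E)"
  have L2: "2 \<le> L" using L by (simp add: L_def)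
  have eL: "exp L = real n" using n by (simp add: L_def)
  have k1: "1 \<le> \<kappa>\<^sup>2" using \<kappa> by (simp add: one_le_power)
  have K20: "20 * L \<le> K" using mult_right_mono[OF k1, of "20 * L"] L2 by (simp add: K_def L_def[symmetric] mult_ac)
  have K0: "0 < K" using K20 L2 by linarith
  have K14: "K + 1 \<le> real n ^ 14" using cutoff_le[of "real n" \<kappa>] n \<kappa> by (simp add: K_def)
  have n1: "1 \<le> real n" using n by simp
  have E1: "1 \<le> E"
  proof -
    have "1 * 1 \<le> real n ^ 2 * (K + 1)" using n1 K0 by (intro mult_mono one_le_power) auto
    then show ?thesis by (simp add: E_def)
  qed
  have lnE: "ln E \<le> 16 * L"
  proof -
    have "E \<le> real n ^ 2 * real n ^ 14" unfolding E_def using K14 by (intro mult_left_mono) auto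
    also have "\<dots> = real n ^ 16" by (simp add: power_add[symmetric])
    finally have "ln E \<le> ln (real n ^ 16)" using E1 n by (intro ln_mono) auto
    then show ?thesis using n by (simp add: ln_realpow L_def)
  qed
  have sK: "sqrt K \<le> 5 * L * \<kappa>"
  proof (rule real_le_lsqrt)
    have "K \<le> 25 * \<kappa>\<^sup>2 * L * L"
    proof -
      have "20 * \<kappa>\<^sup>2 * L * 1 \<le> 25 * \<kappa>\<^sup>2 * L * L" using L2 by (intro mult_mono) auto
      then show ?thesis by (simp add: K_def L_def)
    qed
    then show "K \<le> (5 * L * \<kappa>)\<^sup>2" by (simp add: power2_eq_square mult_ac)
  qed (use L2 \<kappa> K0 in auto)
  have Lk: "1 \<le> L * \<kappa>" using mult_mono[of 1 L 1 \<kappa>] L2 \<kappa> by simp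
  have BB: "2 * sqrt K \<le> real B" "real B \<le> 2 * sqrt K + 1" using K0 by (auto simp: B_def)
  have Ble: "real B \<le> 11 * L * \<kappa>" using BB(2) sK Lk by linarith
  have B0: "0 < real B" using BB(1) K0 real_sqrt_gt_zero[OF K0] by linarith
  have B4: "4 * K \<le> real B ^ 2"
    using power_mono[OF BB(1), of 2] K0 by (simp add: power_mult_distrib)
  have B1: "1 \<le> real B" using B0 by simp
  have lnB: "ln (real B) \<le> 9 * L"
  proof -
    have "L \<le> real n" using ln_le_minus_one[of "real n"] n by (simp add: L_def)
    then have "11 * L * \<kappa> \<le> 11 * real n * real n ^ 5" using \<kappa> L2 by (intro mult_mono) auto
    also have "\<dots> \<le> real n ^ 3 * real n * real n ^ 5"
      using power_mono[of 3 "real n" 3] n by (intro mult_right_mono) auto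
    also have "\<dots> = real n ^ 9" by (simp add: power_add[symmetric] power_Suc2[symmetric] del: power_Suc2)
    finally have "real B \<le> real n ^ 9" using Ble by linarith
    then have "ln (real B) \<le> ln (real n ^ 9)" using B0 by (intro ln_mono) auto
    then show ?thesis using n by (simp add: ln_realpow L_def)
  qed
  have ln16: "ln (16 :: real) \<le> 15" using ln_le_minus_one[of 16] by simp
  have ln11: "ln (11 :: real) \<le> 10" using ln_le_minus_one[of 11] by simp
  have lnX: "ln (16 * exp 6 * E) = ln 16 + 6 + ln E" using E1 by (simp add: ln_mult)
  have DD: "2 * ln (16 * exp 6 * E) \<le> real D" "real D \<le> 2 * ln (16 * exp 6 * E) + 1"
  proof -
    have "0 \<le> ln (16 * exp 6 * E)" unfolding lnX using E1 by (simp add: ln_ge_zero add_nonneg_nonneg)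
    then show "2 * ln (16 * exp 6 * E) \<le> real D" "real D \<le> 2 * ln (16 * exp 6 * E) + 1"
      unfolding D_def by linarith+
  qed
  have Dle: "real D \<le> 54 * L" using DD(2) lnE ln16 L2 unfolding lnX distrib_left by linarith
  have half: "(1/2) ^ D \<le> 1 / (16 * exp 6 * E)"
  proof -
    have "16 * exp 6 * E = exp (ln (16 * exp 6 * E))" using E1 by simp
    also have "\<dots> \<le> exp (real D * ln 2)"
    proof -
      have "real D * (1/2) \<le> real D * ln 2" using ln2_ge_two_thirds by (intro mult_left_mono) auto
      then show ?thesis using DD(1) by simp
    qed
    also have "\<dots> = 2 ^ D" by (simp add: exp_of_nat_mult)
    finally show ?thesis using E1 by (simp add: power_divide field_simps)
  qed
  have eK: "2 * exp (- K) \<le> 1 / (4 * E)"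
  proof -
    have "16 * real n ^ 2 \<le> real n ^ 10"
    proof -
      have "16 * real n ^ 2 \<le> real n ^ 8 * real n ^ 2"
        using power_mono[of 3 "real n" 8] n by (intro mult_right_mono) auto
      then show ?thesis by (simp add: power_add[symmetric])
    qed
    also have "\<dots> = exp (10 * L)" unfolding eL[symmetric] by (simp add: exp_of_nat_mult[symmetric])
    also have "\<dots> \<le> exp (K / 2)" using K20 by simp
    finally have "16 * real n ^ 2 \<le> exp (K / 2)" .
    moreover have "(K + 1) / 2 \<le> exp (K / 2)" using exp_ge_add_one_self[of "K / 2"] K0
      unfolding add_divide_distrib by linarith
    ultimately have "16 * real n ^ 2 * ((K + 1) / 2) \<le> exp (K / 2) * exp (K / 2)"
      using K0 by (intro mult_mono) auto
    then have "8 * E \<le> exp K" by (simp add: E_def exp_add[symmetric] mult_ac)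
    then show ?thesis using E1 by (simp add: exp_minus field_simps)
  qed
  have \<delta>: "0 < \<delta>" using B0 E1 by (simp add: \<delta>_def)
  obtain \<Phi> :: "real measure \<Rightarrow> nat \<times> nat \<Rightarrow> int" where
    \<Phi>: "finite (\<Phi> ` prob_nonneg)" "real (card (\<Phi> ` prob_nonneg)) \<le> (2 / \<delta> + 3) ^ (B * D)"
    "\<And>Q Q' k d. \<Phi> Q = \<Phi> Q' \<Longrightarrow> k < B \<Longrightarrow> d < D \<Longrightarrow>
       \<bar>block_moment Q k d - block_moment Q' k d\<bar> \<le> \<delta>"
    using moment_partition[OF \<delta>] by metis
  have "2 / \<delta> + 3 \<le> 11 * exp 6 * real B * E"
  proof -
    have "1 * 1 * 1 \<le> exp 6 * real B * E" using B1 E1 by (intro mult_mono) auto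
    then show ?thesis by (simp add: \<delta>_def mult_ac)
  qed
  then have "ln (2 / \<delta> + 3) \<le> ln (11 * exp 6 * real B * E)" using \<delta> by (intro ln_mono) (auto simp: add_pos_pos)
  also have "\<dots> = ln 11 + 6 + ln (real B) + ln E" using B0 E1 by (simp add: ln_mult)
  also have "\<dots> \<le> 33 * L" using ln11 lnB lnE L2 by linarith
  finally have lnd: "ln (2 / \<delta> + 3) \<le> 33 * L" .
  have d3: "0 < 2 / \<delta> + 3" using \<delta> by (simp add: add_pos_pos)
  have "(2 / \<delta> + 3) ^ (B * D) = exp (real (B * D) * ln (2 / \<delta> + 3))"
    using d3 by (simp only: exp_of_nat_mult exp_ln)
  \<comment> \<open>The factors bound the number of blocks, the number of degrees and the logarithm
    of the number of grid values; 11 * 54 * 33 = 19602.\<close>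
  also have "\<dots> \<le> exp ((11 * L * \<kappa>) * (54 * L) * (33 * L))"
    unfolding exp_le_cancel_iff of_nat_mult
    using Ble Dle lnd L2 \<kappa> \<delta> by (intro mult_mono mult_nonneg_nonneg ln_ge_zero) auto
  also have "\<dots> \<le> exp (20000 * \<kappa> * ln (real n) ^ 3)"
  proof -
    have "19602 * (\<kappa> * L ^ 3) \<le> 20000 * (\<kappa> * L ^ 3)" using \<kappa> L2 by (intro mult_right_mono) auto
    then show ?thesis by (simp add: L_def[symmetric] power3_eq_cube mult_ac)
  qed
  finally have "(2 / \<delta> + 3) ^ (B * D) \<le> exp (20000 * \<kappa> * ln (real n) ^ 3)" .
  with \<Phi>(2) have card: "real (card (\<Phi> ` prob_nonneg)) \<le> exp (20000 * \<kappa> * ln (real n) ^ 3)" by linarith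
  have close: "mixture Q y \<le> mixture Q' y + 1 / (real n ^ 2 * (K + 1))"
    if "Q \<in> prob_nonneg" "Q' \<in> prob_nonneg" "\<Phi> Q = \<Phi> Q'" "real y \<le> K" for Q Q' y
  proof -
    have "\<bar>mixture Q y - mixture Q' y\<bar>
        \<le> 2 * (2 * exp 6 * (1/2) ^ D + exp (- K)) + 2 * exp 6 * real B * \<delta>"
      by (rule mixture_close[OF that(1,2) \<Phi>(3)[OF that(3)] that(4) B4]) (use \<delta> in auto)
    moreover have "2 * (2 * exp 6 * (1/2) ^ D + exp (- K)) = 4 * exp 6 * (1/2) ^ D + 2 * exp (- K)"
      by (simp add: algebra_simps)
    moreover have "2 * exp 6 * real B * \<delta> = 1 / (2 * E)" using B0 E1 by (simp add: \<delta>_def)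
    moreover have "4 * exp 6 * (1/2) ^ D \<le> 1 / (4 * E)"
      using mult_left_mono[OF half, of "4 * exp 6"] E1 by simp
    moreover have "1 / (4 * E) + 1 / (4 * E) + 1 / (2 * E) = 1 / E" using E1 by (simp add: field_simps)
    ultimately show ?thesis using eK unfolding E_def[symmetric] by linarith
  qed
  show ?thesis by (rule that[OF \<Phi>(1) card close])
qed

text \<open>The squared radius \<open>n * rate\<^sup>2\<close> equals \<open>\<kappa> * (ln n) ^ 8\<close>, where \<open>\<kappa>\<close> is the order of the
  square root of the truncation level.\<close>

lemma rate_decomposition:
  fixes p M :: real and n :: nat
  assumes p: "0 < p" and M: "0 < M" and n: "3 \<le> n" and Mn: "M powr (1 / p) \<le> real n ^ 10"
  obtains \<kappa> where "1 \<le> \<kappa>" "\<kappa> \<le> real n ^ 5" "real n * M \<le> \<kappa> powr (2 * p + 1)"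
    "real n * (rate p M n)\<^sup>2 = \<kappa> * ln (real n) ^ 8" "0 \<le> rate p M n"
proof -
  define N where "N = real n"
  define e where "e = 1 / (4 * p + 2)"
  \<comment> \<open>\<open>\<mu>\<close> is the rate without its factors
    \<open>n powr (- 1 / 2)\<close> and \<open>ln n ^ 4\<close>; the required
    \<open>\<kappa>\<close> is its square.\<close>
  define \<mu> where "\<mu> = max ((N * M) powr e) 1"
  have N: "3 \<le> N" using n by (simp add: N_def)
  have e: "0 < e" "(2 * p + 1) * (2 * e) = 1" using p by (auto simp: e_def field_simps)
  have \<mu>1: "1 \<le> \<mu>" by (simp add: \<mu>_def)
  have "N powr (- p / (2 * p + 1)) = N powr (- 1 / 2) * N powr e"
  proof -
    have "- p / (2 * p + 1) = - 1 / 2 + e" using p by (simp add: e_def field_simps)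
    then show ?thesis by (simp only: powr_add)
  qed
  then have "N powr (- p / (2 * p + 1)) * M powr e = N powr (- 1 / 2) * (N * M) powr e"
    using N M by (simp add: powr_mult)
  then have rate: "rate p M n = N powr (- 1 / 2) * \<mu> * ln N ^ 4"
    unfolding rate_def \<mu>_def N_def[symmetric] e_def[symmetric]
    by (simp add: max_mult_distrib_left)
  have "real n * (rate p M n)\<^sup>2 = N * (N powr (- 1 / 2))\<^sup>2 * \<mu>\<^sup>2 * (ln N ^ 4)\<^sup>2"
    unfolding rate N_def[symmetric] by (simp add: power_mult_distrib)
  also have "N * (N powr (- 1 / 2))\<^sup>2 = 1"
    using N by (simp add: power2_eq_square powr_add[symmetric] powr_minus_divide)
  also have "(ln N ^ 4)\<^sup>2 = ln N ^ 8" by (simp add: power_mult[symmetric])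
  finally have 4: "real n * (rate p M n)\<^sup>2 = \<mu>\<^sup>2 * ln (real n) ^ 8" by (simp add: N_def)
  \<comment> \<open>The assumption on \<open>M\<close> is used only to keep \<open>\<kappa>\<close>
    polynomial in \<open>n\<close>: the exponent \<open>(1 + 10 * p) / (4 * p + 2)\<close> is at
    most 5/2 for every \<open>p\<close>.\<close>
  have "M = (M powr (1 / p)) powr p" using M p by (simp add: powr_powr)
  also have "\<dots> \<le> (N ^ 10) powr p" using Mn p by (intro powr_mono2) (auto simp: N_def)
  also have "\<dots> = N powr (10 * p)" using N by (simp add: powr_powr flip: powr_numeral)
  finally have "N * M \<le> N powr 1 * N powr (10 * p)" using N by simp
  also have "\<dots> = N powr (1 + 10 * p)" by (simp only: powr_add)
  finally have "(N * M) powr e \<le> (N powr (1 + 10 * p)) powr e"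
    using N M e by (intro powr_mono2) auto
  also have "\<dots> = N powr ((1 + 10 * p) * e)" by (simp add: powr_powr)
  also have "\<dots> \<le> N powr (5 / 2)" using N p by (intro powr_mono) (auto simp: e_def field_simps)
  finally have "(N * M) powr e \<le> N powr (5 / 2)" .
  moreover have "1 \<le> N powr (5 / 2)" using N by (simp add: ge_one_powr_ge_zero)
  ultimately have "\<mu> \<le> N powr (5 / 2)" by (simp add: \<mu>_def)
  then have "\<mu>\<^sup>2 \<le> (N powr (5 / 2))\<^sup>2" using \<mu>1 by (intro power_mono) auto
  also have "\<dots> = N powr 5" by (simp add: power2_eq_square powr_add[symmetric])
  also have "\<dots> = N ^ 5" using N by (simp add: powr_numeral)
  finally have 2: "\<mu>\<^sup>2 \<le> real n ^ 5" by (simp add: N_def)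
  have "N * M = ((N * M) powr (2 * e)) powr (2 * p + 1)"
    using N M e(2) by (simp add: powr_powr mult.commute)
  also have "(N * M) powr (2 * e) = ((N * M) powr e)\<^sup>2"
    by (simp add: power2_eq_square powr_add[symmetric])
  also have "(((N * M) powr e)\<^sup>2) powr (2 * p + 1) \<le> (\<mu>\<^sup>2) powr (2 * p + 1)"
    using p by (intro powr_mono2 power_mono) (auto simp: \<mu>_def)
  finally have 3: "real n * M \<le> (\<mu>\<^sup>2) powr (2 * p + 1)" by (simp add: N_def)
  have "0 \<le> rate p M n" unfolding rate using \<mu>1 by simp
  moreover have "1 \<le> \<mu>\<^sup>2" using \<mu>1 by (simp add: one_le_power)
  ultimately show ?thesis using that 2 3 4 by blast
qed

text \<open>The first summand absorbs the entropy constant of the cover and the tail sums. The second one makes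
  \<open>t * rate\<close> exceed the diameter of the Hellinger distance when \<open>ln n < max 2 (1 / p)\<close>.\<close>

definition dev_const :: "real \<Rightarrow> real" where
  "dev_const p = 8 * (20001 + tail_const p) + 2 * exp (max 2 (1 / p))"

section \<open>Deviation and risk bounds from the cover and the tail estimates\<close>

lemma ln_ge_1: "3 \<le> n \<Longrightarrow> 1 \<le> ln (real n)"
  using ln3_gt_1 by (intro order.trans[of 1 "ln 3" "ln (real n)"]) (auto intro: ln_mono)

text \<open>The two events contribute one exponential each, hence the factor 2. The cover event
  leaves the exponent \<open>- X / 16\<close>, at most \<open>- X / (8 * l)\<close> because
  \<open>2 \<le> l\<close>; the tail event starts from \<open>- X / (4 * l)\<close> and gives up
  half of it to the tail sum.\<close>

lemma npmle_deviation_large_sample: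
  fixes p M t :: real and n :: nat
  assumes p: "0 < p" and M: "0 < M" and n: "3 \<le> n" and Mn: "M powr (1 / p) \<le> real n ^ 10"
    and G: "G \<in> moment_class p M" and np: "\<And>Y. is_npmle n Y (Ghat Y)" and t: "dev_const p \<le> t"
    and L: "2 \<le> ln (real n)" "1 / p \<le> ln (real n)"
  shows "\<P>(Y in sample_law n G. t * rate p M n \<le> hellinger (mixture (Ghat Y)) (mixture G))
    \<le> 2 * exp (- (t\<^sup>2 * real n * (rate p M n)\<^sup>2 / (8 * ln (real n))))"
proof -
  define l where "l = ln (real n)"
  define T where "T = tail_const p"
  have G': "G \<in> prob_nonneg" "moment p G \<le> ennreal M" using G by (auto simp: moment_class_def)
  obtain \<kappa> where \<kappa>: "1 \<le> \<kappa>" "\<kappa> \<le> real n ^ 5" "real n * M \<le> \<kappa> powr (2 * p + 1)"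
    and rate: "real n * (rate p M n)\<^sup>2 = \<kappa> * l ^ 8" "0 \<le> rate p M n"
    using rate_decomposition[OF p M n Mn] unfolding l_def by metis
  define K where "K = 20 * \<kappa>\<^sup>2 * l"
  define r where "r = 1 / (2 * l)"
  define \<tau> where "\<tau> = (\<lambda>y. if K < real y then mixture G y powr (1 - r) else 0)"
  have l2: "2 \<le> l" using L by (simp add: l_def)
  have T0: "0 \<le> T" by (simp add: T_def tail_const_nonneg)
  have "20001 + T \<le> t" "8 * (20001 + T) \<le> t" using t T0 exp_gt_zero[of "max 2 (1 / p)"]
    by (auto simp: dev_const_def T_def[symmetric] simp del: exp_gt_zero)
  then have t: "8 * (20001 + T) \<le> t" "1 \<le> t" using T0 by auto
  have t2: "8 * (20001 + T) \<le> t\<^sup>2"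
    using mult_mono[OF t(2) t(1)] t T0 by (simp add: power2_eq_square)
  have r: "0 \<le> r" "r \<le> 1" using l2 by (auto simp: r_def field_simps)
  have K0: "0 \<le> K" using l2 by (simp add: K_def)
  obtain \<Phi> :: "real measure \<Rightarrow> nat \<times> nat \<Rightarrow> int" where \<Phi>: "finite (\<Phi> ` prob_nonneg)"
    "real (card (\<Phi> ` prob_nonneg)) \<le> exp (20000 * \<kappa> * l ^ 3)"
    "\<And>Q Q' y. Q \<in> prob_nonneg \<Longrightarrow> Q' \<in> prob_nonneg \<Longrightarrow> \<Phi> Q = \<Phi> Q' \<Longrightarrow> real y \<le> K \<Longrightarrow>
       mixture Q y \<le> mixture Q' y + 1 / (real n ^ 2 * (K + 1))"
    using mixture_cover[OF n L(1) \<kappa>(1,2)] unfolding l_def[symmetric] K_def[symmetric] by metis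
  have tail: "summable \<tau>" "real n * (\<Sum>y. \<tau> y) \<le> T * \<kappa>"
    unfolding \<tau>_def K_def r_def l_def T_def
    using mixture_tail_bound[OF p G' _ _ L \<kappa>] M n by auto
  have h2: "real n * (t * rate p M n)\<^sup>2 = t\<^sup>2 * (\<kappa> * l ^ 8)"
    unfolding rate(1)[symmetric] by (simp add: power_mult_distrib)
  define X where "X = t\<^sup>2 * (\<kappa> * l ^ 8)"
  have pw: "1 \<le> l ^ 7" "l ^ 3 \<le> l ^ 8" "1 \<le> l ^ 8" "l ^ 8 = l * l ^ 7"
    using l2 by (auto intro: one_le_power power_increasing simp: power_Suc[symmetric] simp del: power_Suc)
  have X16: "X / (8 * l) \<le> X / 16" using l2 \<kappa> by (intro divide_left_mono) (auto simp: X_def)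
  have X7: "X / (8 * l) = t\<^sup>2 * (\<kappa> * l ^ 7) / 8" using l2 by (simp add: X_def pw(4))
  have B: "T * \<kappa> \<le> X / (8 * l)"
  proof -
    have "T * (\<kappa> * 1) \<le> t\<^sup>2 / 8 * (\<kappa> * l ^ 7)"
      using t2 T0 \<kappa> pw(1) by (intro mult_mono mult_left_mono) auto
    then show ?thesis unfolding X7 by simp
  qed
  \<comment> \<open>3/16 is 1/4 - 1/16: entropy and tail sum may use up this part of
    \<open>X / 4\<close>.\<close>
  have A: "20000 * \<kappa> * l ^ 3 + 1 + T * \<kappa> \<le> 3 / 16 * X"
  proof -
    define u where "u = \<kappa> * l ^ 8"
    have u: "\<kappa> * l ^ 3 \<le> u" "\<kappa> \<le> u"
      using mult_left_mono[OF pw(2), of \<kappa>] mult_left_mono[OF pw(3), of \<kappa>] \<kappa> by (auto simp: u_def)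
    have u1: "1 \<le> u" using u \<kappa> by simp
    have "20000 * (\<kappa> * l ^ 3) + 1 + T * \<kappa> \<le> 20000 * u + u + T * u"
      using u u1 T0 by (intro add_mono mult_left_mono) auto
    also have "\<dots> = (20001 + T) * u" by (simp add: algebra_simps)
    also have "\<dots> \<le> 3 / 16 * t\<^sup>2 * u" using t2 u1 T0 by (intro mult_right_mono) auto
    finally show ?thesis by (simp add: X_def u_def)
  qed
  have "\<P>(Y in sample_law n G. t * rate p M n \<le> hellinger (mixture (Ghat Y)) (mixture G))
    \<le> exp (20000 * \<kappa> * l ^ 3) * exp (- (real n * (t * rate p M n)\<^sup>2 / 4) + 1 + real n * (\<Sum>y. \<tau> y))
      + exp (- (r * (real n * (t * rate p M n)\<^sup>2 / 2)) + real n * (\<Sum>y. \<tau> y))"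
    unfolding \<tau>_def
    by (rule npmle_deviation_by_cover[OF G'(1) _ K0 _ r np \<Phi> tail(1)[unfolded \<tau>_def]])
      (use n t rate(2) in auto)
  also have "\<dots> = exp (20000 * \<kappa> * l ^ 3 + (- (X / 4) + 1 + real n * (\<Sum>y. \<tau> y)))
      + exp (- (X / (4 * l)) + real n * (\<Sum>y. \<tau> y))"
    unfolding h2 X_def[symmetric] by (simp add: exp_add[symmetric] r_def)
  also have "\<dots> \<le> exp (- (X / (8 * l))) + exp (- (X / (8 * l)))"
  proof (intro add_mono)
    show "exp (20000 * \<kappa> * l ^ 3 + (- (X / 4) + 1 + real n * (\<Sum>y. \<tau> y))) \<le> exp (- (X / (8 * l)))"
      unfolding exp_le_cancel_iff using tail(2) A X16 by linarith
    have "X / (4 * l) = 2 * (X / (8 * l))" by simp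
    then show "exp (- (X / (4 * l)) + real n * (\<Sum>y. \<tau> y)) \<le> exp (- (X / (8 * l)))"
      unfolding exp_le_cancel_iff using tail(2) B by linarith
  qed
  also have "X = t\<^sup>2 * real n * (rate p M n)\<^sup>2"
    unfolding X_def rate(1)[symmetric] by simp
  finally show ?thesis by (simp add: l_def)
qed

lemma rate_sq_lower:
  assumes "0 < p" "0 < M" "3 \<le> n" "M powr (1 / p) \<le> real n ^ 10"
  shows "ln (real n) ^ 8 \<le> real n * (rate p M n)\<^sup>2" "0 \<le> rate p M n"
proof -
  obtain \<kappa> where "1 \<le> \<kappa>" "real n * (rate p M n)\<^sup>2 = \<kappa> * ln (real n) ^ 8" "0 \<le> rate p M n"
    using rate_decomposition[OF assms] by metis
  moreover have "0 \<le> ln (real n) ^ 8" by simp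
  ultimately show "ln (real n) ^ 8 \<le> real n * (rate p M n)\<^sup>2" "0 \<le> rate p M n"
    using mult_right_mono[of 1 \<kappa> "ln (real n) ^ 8"] by auto
qed

lemma npmle_deviation:
  assumes p: "0 < p" and M: "0 < M" and n: "3 \<le> n" and Mn: "M powr (1 / p) \<le> real n ^ 10"
    and G: "G \<in> moment_class p M" and np: "\<And>Y. is_npmle n Y (Ghat Y)" and t: "dev_const p \<le> t"
  shows "\<P>(Y in sample_law n G. t * rate p M n \<le> hellinger (mixture (Ghat Y)) (mixture G))
    \<le> 2 * exp (- (t\<^sup>2 * real n * (rate p M n)\<^sup>2 / (8 * ln (real n))))"
proof (cases "2 \<le> ln (real n) \<and> 1 / p \<le> ln (real n)")
  case True
  then show ?thesis using npmle_deviation_large_sample[OF p M n Mn G np t] by simp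
next
  case False
  define m where "m = max 2 (1 / p)"
  have G': "G \<in> prob_nonneg" using G by (simp add: moment_class_def)
  have "ln (real n) < m" using False by (auto simp: m_def)
  then have nm: "real n < exp m" using n by (metis exp_less_mono exp_ln of_nat_0_less_iff order.strict_trans2 zero_less_numeral)
  have m1: "1 \<le> exp m" by (simp add: m_def)
  have "2 * exp m \<le> t" using t tail_const_nonneg[of p] by (simp add: dev_const_def m_def[symmetric])
  then have "(2 * exp m)\<^sup>2 \<le> t\<^sup>2" by (intro power_mono) auto
  moreover have "4 * real n < (2 * exp m)\<^sup>2"
  proof -
    have "4 * real n < 4 * (exp m * 1)" using nm by simp
    also have "\<dots> \<le> 4 * (exp m * exp m)" using m1 by (intro mult_left_mono) auto
    finally show ?thesis by (simp add: power2_eq_square)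
  qed
  ultimately have "4 * real n < t\<^sup>2" by linarith
  moreover have "1 \<le> real n * (rate p M n)\<^sup>2"
    using rate_sq_lower(1)[OF p M n Mn] one_le_power[OF ln_ge_1[OF n], of 8] by linarith
  ultimately have "4 * real n * 1 < t\<^sup>2 * (real n * (rate p M n)\<^sup>2)"
    using n by (intro mult_less_le_imp_less) auto
  then have "4 < (t * rate p M n)\<^sup>2" using n by (simp add: power_mult_distrib)
  then have "2\<^sup>2 < (t * rate p M n)\<^sup>2" by simp
  moreover have "0 \<le> t * rate p M n"
  proof (rule mult_nonneg_nonneg)
    show "0 \<le> t" using \<open>2 * exp m \<le> t\<close> m1 by linarith
    show "0 \<le> rate p M n" by (rule rate_sq_lower(2)[OF p M n Mn])
  qed
  ultimately have big: "2 < t * rate p M n" by (rule power_less_imp_less_base)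
  have "hellinger (mixture (Ghat Y)) (mixture G) < t * rate p M n" for Y
  proof -
    have "hellinger (mixture (Ghat Y)) (mixture G) \<le> sqrt 2"
      by (rule hellinger_le_sqrt2[OF npmle_likelihood(1)[OF np G'] G'])
    also have "sqrt 2 \<le> 2" by (rule real_le_lsqrt) auto
    finally show ?thesis using big by simp
  qed
  then have "{Y \<in> space (sample_law n G). t * rate p M n \<le> hellinger (mixture (Ghat Y)) (mixture G)} = {}"
    by (auto simp: not_le)
  then show ?thesis by (simp only: measure_empty) simp
qed

lemma deviation_bound_weaken:
  assumes "0 < p" "0 < M" and n: "3 \<le> n" and "M powr (1 / p) \<le> real n ^ 10"
  shows "2 * exp (- (t\<^sup>2 * real n * (rate p M n)\<^sup>2 / (8 * ln (real n))))
    \<le> 2 * exp (- (t\<^sup>2 * (ln (real n))\<^sup>2 / 8))"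
proof -
  have l: "1 \<le> ln (real n)" by (rule ln_ge_1[OF n])
  \<comment> \<open>The third power is what remains a square after division by
    \<open>ln n\<close>.\<close>
  have "ln (real n) ^ 3 \<le> ln (real n) ^ 8" using l by (intro power_increasing) auto
  also have "\<dots> \<le> real n * (rate p M n)\<^sup>2" by (rule rate_sq_lower[OF assms])
  finally have "t\<^sup>2 * (ln (real n) ^ 3) \<le> t\<^sup>2 * (real n * (rate p M n)\<^sup>2)" by (rule mult_left_mono) simp
  then have "t\<^sup>2 * (ln (real n) ^ 3) / (8 * ln (real n)) \<le> t\<^sup>2 * (real n * (rate p M n)\<^sup>2) / (8 * ln (real n))"
    using l by (intro divide_right_mono) auto
  moreover have "t\<^sup>2 * (ln (real n) ^ 3) / (8 * ln (real n)) = t\<^sup>2 * (ln (real n))\<^sup>2 / 8"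
    using l by (simp add: power2_eq_square power3_eq_cube)
  ultimately show ?thesis by (simp add: mult.assoc)
qed

text \<open>The squared distance is at most 2, so one threshold is enough, without integrating the
  tail: at \<open>t = dev_const p\<close> the exceptional probability is at most
  \<open>2 / n\<close>, which is at most twice the squared rate.\<close>

lemma npmle_risk:
  assumes p: "0 < p" and M: "0 < M" and n: "3 \<le> n" and Mn: "M powr (1 / p) \<le> real n ^ 10"
    and G: "G \<in> moment_class p M" and np: "\<And>Y. is_npmle n Y (Ghat Y)"
  shows "(\<integral>Y. hellinger_sq (mixture (Ghat Y)) (mixture G) \<partial>sample_law n G)
    \<le> ((dev_const p)\<^sup>2 + 4) * (rate p M n)\<^sup>2"
proof -
  have G': "G \<in> prob_nonneg" using G by (simp add: moment_class_def)
  interpret prob_space "sample_law n G" by (rule prob_space_sample_law[OF G'])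
  define t where "t = dev_const p"
  define h where "h = t * rate p M n"
  define H where "H = (\<lambda>Y. hellinger_sq (mixture (Ghat Y)) (mixture G))"
  define S where "S = {Y \<in> space (sample_law n G). h \<le> hellinger (mixture (Ghat Y)) (mixture G)}"
  have Gh: "Ghat Y \<in> prob_nonneg" for Y by (rule npmle_likelihood(1)[OF np G'])
  note Hs = hellinger_sq_pmf(3,4)[OF mixture_sums[OF Gh] mixture_nonneg[OF Gh] mixture_sums[OF G'] mixture_nonneg[OF G']]
  have S: "S \<in> sets (sample_law n G)" unfolding sample_law_eq sets_iid_law by (auto simp: S_def sample_law_eq)
  have t3: "3 \<le> t"
  proof -
    have "8 * (20001 + tail_const p) \<le> t" by (simp add: t_def dev_const_def)
    moreover have "0 \<le> tail_const p" by (rule tail_const_nonneg)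
    ultimately show ?thesis unfolding distrib_left by linarith
  qed
  have h0: "0 \<le> h" using t3 rate_sq_lower(2)[OF p M n Mn] by (simp add: h_def)
  have le: "H Y \<le> h\<^sup>2 + 2 * indicator S Y" if Y: "Y \<in> space (sample_law n G)" for Y
  proof (cases "Y \<in> S")
    case True
    then show ?thesis using Hs(2)[of Y] by (simp add: H_def add_increasing)
  next
    case False
    then have "sqrt (H Y) \<le> h" using Y by (simp add: S_def H_def hellinger_def)
    then have "(sqrt (H Y))\<^sup>2 \<le> h\<^sup>2" using Hs(1)[of Y] by (intro power_mono) (auto simp: H_def)
    then show ?thesis using Hs(1)[of Y] False by (simp add: H_def)
  qed
  have i: "integrable (sample_law n G) (indicator S :: _ \<Rightarrow> real)"
    using S by (simp add: less_top[symmetric])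
  have "(\<integral>Y. H Y \<partial>sample_law n G) \<le> (\<integral>Y. h\<^sup>2 + 2 * indicator S Y \<partial>sample_law n G)"
  \<comment> \<open>This rule asks for integrability of the upper bound only, which is
    nonnegative.\<close>
  proof (rule integral_mono'[OF _ le])
    show "integrable (sample_law n G) (\<lambda>Y. h\<^sup>2 + 2 * indicator S Y)"
      by (intro Bochner_Integration.integrable_add integrable_mult_right i) simp
  qed auto
  also have "\<dots> = (\<integral>Y. h\<^sup>2 \<partial>sample_law n G) + (\<integral>Y. 2 * indicator S Y \<partial>sample_law n G)"
    by (intro Bochner_Integration.integral_add integrable_mult_right i) simp
  also have "\<dots> = h\<^sup>2 + 2 * prob S" using S by (simp add: prob_space)
  also have "prob S \<le> 2 * (rate p M n)\<^sup>2"
  proof -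
    have l: "1 \<le> ln (real n)" by (rule ln_ge_1[OF n])
    have "prob S \<le> 2 * exp (- (t\<^sup>2 * (ln (real n))\<^sup>2 / 8))"
      unfolding S_def h_def
      by (rule order.trans[OF npmle_deviation[OF p M n Mn G np] deviation_bound_weaken[OF p M n Mn]])
        (simp add: t_def)
    also have "\<dots> \<le> 2 * exp (- ln (real n))"
    proof -
      \<comment> \<open>With \<open>8 \<le> t\<^sup>2\<close> and \<open>1 \<le> ln n\<close>, the
        exponent \<open>t\<^sup>2 * (ln n)\<^sup>2 / 8\<close> is at least
        \<open>ln n\<close>.\<close>
      have "8 \<le> t\<^sup>2" using mult_mono[OF t3 t3] t3 by (simp add: power2_eq_square)
      then have "8 * (ln (real n) * 1) \<le> t\<^sup>2 * (ln (real n) * ln (real n))"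
        using l by (intro mult_mono) auto
      then show ?thesis by (simp add: power2_eq_square)
    qed
    also have "\<dots> = 2 * (1 / real n)" using n by (simp add: exp_minus inverse_eq_divide)
    also have "\<dots> \<le> 2 * (rate p M n)\<^sup>2"
    proof -
      have "1 \<le> real n * (rate p M n)\<^sup>2"
        using rate_sq_lower(1)[OF p M n Mn] one_le_power[OF l, of 8] by linarith
      then show ?thesis using n by (simp add: field_simps)
    qed
    finally show ?thesis .
  qed
  finally show ?thesis by (simp add: H_def h_def t_def power_mult_distrib algebra_simps)
qed

theorem theorem1:
  fixes p :: real
  assumes "p > 0"
  shows "(\<exists>t_star::real. \<forall>(Mp::real) (n::nat) (G::real measure) (Ghat::(nat \<Rightarrow> nat) \<Rightarrow> real measure).
            Mp > 0 \<longrightarrow> n \<ge> 3 \<longrightarrow> Mp powr (1 / p) \<le> real n ^ 10 \<longrightarrow> G \<in> moment_class p Mp \<longrightarrow>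
            (\<forall>Y. is_npmle n Y (Ghat Y)) \<longrightarrow>
            (\<forall>t\<ge>t_star.
               \<P>(Y in sample_law n G. hellinger (mixture (Ghat Y)) (mixture G) \<ge> t * rate p Mp n)
                 \<le> 2 * exp (- (t\<^sup>2 * real n * (rate p Mp n)\<^sup>2 / (8 * ln (real n)))) \<and>
               2 * exp (- (t\<^sup>2 * real n * (rate p Mp n)\<^sup>2 / (8 * ln (real n))))
                 \<le> 2 * exp (- (t\<^sup>2 * (ln (real n))\<^sup>2 / 8))))
       \<and> (\<exists>C::real. C > 0 \<and>
          (\<forall>(Mp::real) (n::nat) (G::real measure) (Ghat::(nat \<Rightarrow> nat) \<Rightarrow> real measure).
            Mp > 0 \<longrightarrow> n \<ge> 3 \<longrightarrow> Mp powr (1 / p) \<le> real n ^ 10 \<longrightarrow> G \<in> moment_class p Mp \<longrightarrow>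
            (\<forall>Y. is_npmle n Y (Ghat Y)) \<longrightarrow>
            (\<integral>Y. hellinger_sq (mixture (Ghat Y)) (mixture G) \<partial>sample_law n G)
              \<le> C * (rate p Mp n)\<^sup>2))"
proof (rule conjI)
  show "\<exists>t_star::real. \<forall>(Mp::real) (n::nat) (G::real measure) (Ghat::(nat \<Rightarrow> nat) \<Rightarrow> real measure).
      Mp > 0 \<longrightarrow> n \<ge> 3 \<longrightarrow> Mp powr (1 / p) \<le> real n ^ 10 \<longrightarrow> G \<in> moment_class p Mp \<longrightarrow>
      (\<forall>Y. is_npmle n Y (Ghat Y)) \<longrightarrow>
      (\<forall>t\<ge>t_star.
         \<P>(Y in sample_law n G. hellinger (mixture (Ghat Y)) (mixture G) \<ge> t * rate p Mp n)
           \<le> 2 * exp (- (t\<^sup>2 * real n * (rate p Mp n)\<^sup>2 / (8 * ln (real n)))) \<and>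
         2 * exp (- (t\<^sup>2 * real n * (rate p Mp n)\<^sup>2 / (8 * ln (real n))))
           \<le> 2 * exp (- (t\<^sup>2 * (ln (real n))\<^sup>2 / 8)))"
    by (intro exI[of _ "dev_const p"] allI impI conjI npmle_deviation deviation_bound_weaken)
      (use assms in auto)
next
  have "0 < (dev_const p)\<^sup>2 + 4" by (simp add: add_nonneg_pos)
  then show "\<exists>C::real. C > 0 \<and>
      (\<forall>(Mp::real) (n::nat) (G::real measure) (Ghat::(nat \<Rightarrow> nat) \<Rightarrow> real measure).
        Mp > 0 \<longrightarrow> n \<ge> 3 \<longrightarrow> Mp powr (1 / p) \<le> real n ^ 10 \<longrightarrow> G \<in> moment_class p Mp \<longrightarrow>
        (\<forall>Y. is_npmle n Y (Ghat Y)) \<longrightarrow>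
        (\<integral>Y. hellinger_sq (mixture (Ghat Y)) (mixture G) \<partial>sample_law n G)
          \<le> C * (rate p Mp n)\<^sup>2)"
    by (intro exI[of _ "(dev_const p)\<^sup>2 + 4"] allI impI conjI npmle_risk) (use assms in auto)
qed

end
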